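(* For spin $j=1$, neither of the set of absolutely Wigner positive states and the set of symmetric absolutely separable states is contained in the other. In particular, there exists a spin-$1$ state that admits a positive Glauber–Sudarshan function (and is even symmetric absolutely separable) but whose Wigner function takes a negative value somewhere on $S^2$; and there exists a spin-$1$ state that is absolutely Wigner positive (so has an everywhere non-negative Wigner function) but does not admit a positive Glauber–Sudarshan function.
   Context: A spin-$j$ state is a positive semidefinite operator $\rho$ of trace $1$ on $\mathbb C^{2j+1}$, which carries the irreducible spin-$j$ representation $g\mapsto U_g$ of $\mathrm{SU}(2)$ with Dicke basis $|j,m\rangle$, $m=-j,\dots,j$. Wigner function: the kernel eigenvalues are $\Delta_{j,m}=\sum_{L=0}^{2j}\frac{2L+1}{2j+1}C^{j,m}_{j,m;L,0}$ (Clebsch–Gordan coefficients $C^{J,M}_{j_1,m_1;j_2,m_2}$), the Wigner kernel is $\Delta(\Omega)=U_g\big(\sum_m\Delta_{j,m}|j,m\rangle\langle j,m|\big)U_g^\dagger$ where $g\in\mathrm{SU}(2)$ rotates the North pole to $\Omega\in S^2$, and $W_\rho(\Omega)=\mathrm{Tr}[\rho\Delta(\Omega)]$. A state $\rho$ is absolutely Wigner positive (AWP) if $W_{U\rho U^\dagger}(\Omega)\ge0$ for all $\Omega\in S^2$ and all $U\in\mathrm{SU}(2j+1)$. Glauber–Sudarshan function: the spin coherent states are $|\Omega\rangle=U_g|j,j\rangle$, with $g$ rotating the North pole to $\Omega$. A Glauber–Sudarshan ($P$) function of $\rho$ is any (generalized) function $P_\rho$ on $S^2$ with $\rho=\frac{2j+1}{4\pi}\int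 P_\rho(\Omega)|\Omega\rangle\langle\Omega|\,d\Omega$; it is not unique. The state $\rho$ admits a positive Glauber–Sudarshan function if it has such a representation with non-negative $P_\rho$ (a non-negative measure being allowed), i.e. if $\rho$ is a convex combination of projectors $|\Omega\rangle\langle\Omega|$ onto spin coherent states; equivalently, $\rho$ viewed as a symmetric state of $2j$ qubits is separable. A state $\rho$ is symmetric absolutely separable (SAS) if $U\rho U^\dagger$ admits a positive Glauber–Sudarshan function for every $U\in\mathrm{SU}(2j+1)$. *)

theory Defs
  imports
    "HOL-Analysis.Analysis"
    "HOL-Computational_Algebra.Polynomial"
    "Jordan_Normal_Form.Schur_Decomposition"
begin

no_notation vec_index (infixl "$" 100)

text \<open>
  The spin \<open>j\<close> is given by the natural number \<open>N = 2j\<close>. Operators are complex matrices of size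
  \<open>N + 1\<close>, written in the Dicke basis in the order \<open>|j,j\<rangle>, |j,j-1\<rangle>, \<dots>, |j,-j\<rangle>\<close>, so the basis
  index \<open>i\<close> stands for \<open>m = j - i\<close>.
\<close>

definition mtrace :: "complex mat \<Rightarrow> complex" where
  "mtrace A = (\<Sum>i<dim_row A. A $$ (i, i))"

definition psd :: "complex mat \<Rightarrow> bool" where
  "psd A \<longleftrightarrow> (\<forall>v\<in>carrier_vec (dim_col A).
      Im ((A *\<^sub>v v) \<bullet>c v) = 0 \<and> 0 \<le> Re ((A *\<^sub>v v) \<bullet>c v))"

definition spin_state :: "nat \<Rightarrow> complex mat \<Rightarrow> bool" where
  "spin_state N \<rho> \<longleftrightarrow> \<rho> \<in> carrier_mat (N + 1) (N + 1) \<and> psd \<rho> \<and> mtrace \<rho> = 1"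

definition SU :: "nat \<Rightarrow> complex mat set" where
  "SU n = {U \<in> carrier_mat n n. U * mat_adjoint U = 1\<^sub>m n \<and> det U = 1}"

definition conj_by :: "complex mat \<Rightarrow> complex mat \<Rightarrow> complex mat" where
  "conj_by U A = U * A * mat_adjoint U"

definition ket_bra :: "complex vec \<Rightarrow> complex mat" where
  "ket_bra v = mat (dim_vec v) (dim_vec v) (\<lambda>(r, c). vec_index v r * cnj (vec_index v c))"


subsection \<open>The irreducible representation of SU(2)\<close>

text \<open>
  The spin-\<open>j\<close> representation is the action of \<open>g\<close> on binary forms of degree \<open>N\<close> in \<open>e\<^sub>1, e\<^sub>2\<close>
  (spin up, spin down), with \<open>g e\<^sub>1 = g\<^sub>0\<^sub>0 e\<^sub>1 + g\<^sub>1\<^sub>0 e\<^sub>2\<close> and \<open>g e\<^sub>2 = g\<^sub>0\<^sub>1 e\<^sub>1 + g\<^sub>1\<^sub>1 e\<^sub>2\<close>. The Dicke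
  vector of index \<open>i\<close> is \<open>sqrt (N choose i) e\<^sub>1\<^bsup>N-i\<^esup> e\<^sub>2\<^bsup>i\<^esup>\<close>. The polynomial below is the image of
  \<open>e\<^sub>1\<^bsup>N-i\<^esup> e\<^sub>2\<^bsup>i\<^esup>\<close>, dehomogenised by \<open>e\<^sub>1 = 1\<close>, \<open>e\<^sub>2 = x\<close>.
\<close>

definition spin_rep :: "nat \<Rightarrow> complex mat \<Rightarrow> complex mat" where
  "spin_rep N g = mat (N + 1) (N + 1) (\<lambda>(k, i).
     complex_of_real (sqrt (real (N choose i) / real (N choose k))) *
     coeff ([:g $$ (0,0), g $$ (1,0):] ^ (N - i) * [:g $$ (0,1), g $$ (1,1):] ^ i) k)"

abbreviation S2 :: "(real ^ 3) set" where
  "S2 \<equiv> sphere 0 1"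

text \<open>\<open>\<Omega>\<^sub>x \<sigma>\<^sub>x + \<Omega>\<^sub>y \<sigma>\<^sub>y + \<Omega>\<^sub>z \<sigma>\<^sub>z\<close> with the Pauli matrices.\<close>

definition pauli :: "real ^ 3 \<Rightarrow> complex mat" where
  "pauli \<Omega> = mat_of_rows_list 2
     [[complex_of_real (\<Omega> $ 3), Complex (\<Omega> $ 1) (- (\<Omega> $ 2))],
      [Complex (\<Omega> $ 1) (\<Omega> $ 2), - complex_of_real (\<Omega> $ 3)]]"

definition north :: "real ^ 3" where
  "north = axis 3 1"

text \<open>
  The rotation \<open>R\<close> covered by \<open>g\<close> is given by \<open>g (n \<cdot> \<sigma>) g\<^sup>\<dagger> = (R n) \<cdot> \<sigma>\<close>.
\<close>

definition rotates_north_to :: "complex mat \<Rightarrow> real ^ 3 \<Rightarrow> bool" where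
  "rotates_north_to g \<Omega> \<longleftrightarrow> g \<in> SU 2 \<and> conj_by g (pauli north) = pauli \<Omega>"

text \<open>
  Two choices of \<open>g\<close> differ by a diagonal right factor, which acts diagonally in the Dicke basis,
  so the kernel and the coherent projectors below do not depend on the choice.
\<close>

definition rotor :: "real ^ 3 \<Rightarrow> complex mat" where
  "rotor \<Omega> = (SOME g. rotates_north_to g \<Omega>)"

lemma mat_adjoint_simps:
  "dim_row (mat_adjoint A) = dim_col A"
  "dim_col (mat_adjoint A) = dim_row A"
  "i < dim_col A \<Longrightarrow> j < dim_row A \<Longrightarrow> mat_adjoint A $$ (i,j) = conjugate (A $$ (j,i))"
  by (auto simp: mat_adjoint_def mat_of_rows_def)

lemma axis3_simps:
  "axis (3::3) (1::real) $ 1 = 0" "axis (3::3) (1::real) $ 2 = 0"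
  "axis (3::3) (1::real) $ 3 = 1"
  by (auto simp: axis_def)

lemma rotates_north_toI:
  assumes "cmod a ^ 2 + cmod b ^ 2 = 1"
    and "\<Omega> $ 3 = cmod a ^ 2 - cmod b ^ 2" "Complex (\<Omega> $ 1) (\<Omega> $ 2) = 2 * cnj a * b"
  shows "rotates_north_to (mat_of_rows_list 2 [[a, - cnj b],[b, cnj a]]) \<Omega>"
proof -
  let ?g = "mat_of_rows_list 2 [[a, - cnj b],[b, cnj a]]"
  have e: "a * cnj a + b * cnj b = 1"
    using assms(1) by (simp add: complex_norm_square[symmetric] flip: of_real_power of_real_add)
  have 3: "complex_of_real (\<Omega> $ 3) = a * cnj a - b * cnj b"
    by (simp add: assms(2) flip: complex_norm_square)
  have 1: "Complex (\<Omega> $ 1) (- (\<Omega> $ 2)) = 2 * a * cnj b"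
    using arg_cong[OF assms(3), of cnj] by (simp add: complex_eq_iff)
  have c: "?g \<in> carrier_mat 2 2" by (auto simp: mat_of_rows_list_def)
  have g: "?g $$ (0,0) = a" "?g $$ (0,Suc 0) = - cnj b" "?g $$ (Suc 0,0) = b" "?g $$ (Suc 0,Suc 0) = cnj a"
    "dim_row ?g = 2" "dim_col ?g = 2"
    by (simp_all add: mat_of_rows_list_def)
  have p: "pauli w $$ (0,0) = of_real (w $ 3)" "pauli w $$ (0,Suc 0) = Complex (w $ 1) (- (w $ 2))"
    "pauli w $$ (Suc 0,0) = Complex (w $ 1) (w $ 2)" "pauli w $$ (Suc 0,Suc 0) = - of_real (w $ 3)"
    "dim_row (pauli w) = 2" "dim_col (pauli w) = 2" for w
    by (simp_all add: pauli_def mat_of_rows_list_def)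
  have two: "{0..<2::nat} = {0, Suc 0}" "{..<2::nat} = {0, Suc 0}" by auto
  have nz: "Complex 0 0 = 0" "Complex 0 (- 0) = 0" by (simp_all add: complex_eq_iff)
  have u: "?g * mat_adjoint ?g = 1\<^sub>m 2"
    by (rule eq_matI)
      (use e in \<open>auto simp: g mat_adjoint_simps scalar_prod_def two less_2_cases_iff algebra_simps\<close>)
  have dt: "det ?g = 1" using e
    by (simp add: laplace_expansion_column[OF c, of 0] cofactor_def mat_delete_def det_single two g algebra_simps)
  have "conj_by ?g (pauli north) = pauli \<Omega>" unfolding conj_by_def
    by (rule eq_matI)
      (use e 3 1 assms(3) in \<open>auto simp: g p nz axis3_simps north_def mat_adjoint_simps scalar_prod_def
          two less_2_cases_iff algebra_simps\<close>)
  with c u dt show ?thesis by (auto simp: rotates_north_to_def SU_def)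
qed

lemma rotates_north_to_rotor:
  assumes "\<Omega> \<in> S2" shows "rotates_north_to (rotor \<Omega>) \<Omega>"
proof -
  have n: "(\<Omega> $ 1)^2 + (\<Omega> $ 2)^2 + (\<Omega> $ 3)^2 = 1"
    using assms by (simp add: norm_eq_1 inner_vec_def sum_3 power2_eq_square)
  define p where "p = (\<Omega> $ 1)^2 + (\<Omega> $ 2)^2"
  define z where "z = \<Omega> $ 3"
  have pz: "p = (1 - z) * (1 + z)" using n by (auto simp: p_def z_def power2_eq_square algebra_simps)
  have "\<exists>g. rotates_north_to g \<Omega>"
  proof (cases "z = -1")
    case True
    then have "\<Omega> $ 1 = 0 \<and> \<Omega> $ 2 = 0" using pz by (simp add: p_def sum_power2_eq_zero_iff)
    then show ?thesis using rotates_north_toI[of 0 1 \<Omega>] True by (auto simp: z_def complex_eq_iff)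
  next
    case False
    have "z^2 \<le> 1" using n unfolding z_def by (smt (verit) zero_le_power2)
    then have z: "1 + z > 0" using False by (simp add: abs_square_le_1)
    define s where "s = sqrt ((1 + z) / 2)"
    have s: "s > 0" "s^2 = (1 + z)/2" using z by (auto simp: s_def)
    define b where "b = Complex (\<Omega> $ 1) (\<Omega> $ 2) / (2 * of_real s)"
    have "cmod b ^ 2 = p / (4 * s^2)"
      using s by (simp add: b_def norm_divide power_divide norm_mult p_def cmod_power2 power_mult_distrib)
    also have "\<dots> = (1 - z) / 2" using z by (simp add: s pz field_simps)
    finally have b: "cmod b ^ 2 = (1 - z) / 2" .
    have a: "cmod (of_real s) ^ 2 = (1 + z) / 2" by (simp add: s)
    have "Complex (\<Omega> $ 1) (\<Omega> $ 2) = 2 * cnj (of_real s) * b" using s(1) by (simp add: b_def)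
    moreover have "(1 + z) / 2 + (1 - z) / 2 = 1" "z = (1 + z) / 2 - (1 - z) / 2" by (simp_all add: field_simps)
    ultimately have "rotates_north_to (mat_of_rows_list 2 [[of_real s, - cnj b], [b, cnj (of_real s)]]) \<Omega>"
      by (intro rotates_north_toI) (simp_all only: a b z_def[symmetric])
    then show ?thesis by blast
  qed
  then show ?thesis unfolding rotor_def by (rule someI_ex)
qed


subsection \<open>Clebsch-Gordan coefficients\<close>

text \<open>
  Racah's formula, in the Condon-Shortley convention, for \<open>C\<^bsup>J,M\<^esup>\<^bsub>j1,m1;j2,m2\<^esub>\<close>. All six arguments
  are twice the angular momenta, so that they are integers.
\<close>

definition hfact :: "int \<Rightarrow> real" where
  "hfact n = fact (nat (n div 2))"

definition clebsch_gordan :: "int \<Rightarrow> int \<Rightarrow> int \<Rightarrow> int \<Rightarrow> int \<Rightarrow> int \<Rightarrow> real" where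
  "clebsch_gordan j1 m1 j2 m2 J M =
    (if \<bar>m1\<bar> \<le> j1 \<and> \<bar>m2\<bar> \<le> j2 \<and> \<bar>M\<bar> \<le> J \<and> even (j1 - m1) \<and> even (j2 - m2) \<and> even (J - M) \<and>
        M = m1 + m2 \<and> \<bar>j1 - j2\<bar> \<le> J \<and> J \<le> j1 + j2
     then
       sqrt (real_of_int (J + 1) * hfact (J + j1 - j2) * hfact (J - j1 + j2) * hfact (j1 + j2 - J)
             / hfact (j1 + j2 + J + 2)) *
       sqrt (hfact (J + M) * hfact (J - M) * hfact (j1 - m1) * hfact (j1 + m1)
             * hfact (j2 - m2) * hfact (j2 + m2)) *
       (\<Sum>k \<in> {k::nat. 2 * int k \<le> j1 + j2 - J \<and> 2 * int k \<le> j1 - m1 \<and> 2 * int k \<le> j2 + m2 \<and>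
                     0 \<le> J - j2 + m1 + 2 * int k \<and> 0 \<le> J - j1 - m2 + 2 * int k}.
          (- 1) ^ k /
          (fact k * hfact (j1 + j2 - J - 2 * int k) * hfact (j1 - m1 - 2 * int k)
           * hfact (j2 + m2 - 2 * int k) * hfact (J - j2 + m1 + 2 * int k)
           * hfact (J - j1 - m2 + 2 * int k)))
     else 0)"


subsection \<open>Wigner function\<close>

text \<open>The first argument is \<open>2j\<close>, the second is \<open>2m\<close>.\<close>

definition kernel_eigenvalue :: "nat \<Rightarrow> int \<Rightarrow> real" where
  "kernel_eigenvalue N m =
     (\<Sum>L = 0..N. real (2 * L + 1) / real (N + 1) *
        clebsch_gordan (int N) m (2 * int L) 0 (int N) m)"

definition wigner_kernel :: "nat \<Rightarrow> real ^ 3 \<Rightarrow> complex mat" where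
  "wigner_kernel N \<Omega> =
     conj_by (spin_rep N (rotor \<Omega>))
       (mat_diag (N + 1) (\<lambda>i. complex_of_real (kernel_eigenvalue N (int N - 2 * int i))))"

text \<open>
  For Hermitian \<open>\<rho>\<close> the trace is real; \<open>Re\<close> only adjusts the type.
\<close>

definition wigner :: "nat \<Rightarrow> complex mat \<Rightarrow> real ^ 3 \<Rightarrow> real" where
  "wigner N \<rho> \<Omega> = Re (mtrace (\<rho> * wigner_kernel N \<Omega>))"

definition AWP :: "nat \<Rightarrow> complex mat set" where
  "AWP N = {\<rho>. spin_state N \<rho> \<and> (\<forall>U\<in>SU (N + 1). \<forall>\<Omega>\<in>S2. 0 \<le> wigner N (conj_by U \<rho>) \<Omega>)}"


subsection \<open>Glauber-Sudarshan function\<close>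

definition coherent_state :: "nat \<Rightarrow> real ^ 3 \<Rightarrow> complex vec" where
  "coherent_state N \<Omega> = spin_rep N (rotor \<Omega>) *\<^sub>v unit_vec (N + 1) 0"

text \<open>
  The measure \<open>\<mu>\<close> plays the role of \<open>P\<^sub>\<rho>(\<Omega>) d\<Omega>\<close>; the integral of operators is taken entrywise.
\<close>

definition admits_positive_P :: "nat \<Rightarrow> complex mat \<Rightarrow> bool" where
  "admits_positive_P N \<rho> \<longleftrightarrow>
     (\<exists>\<mu> :: (real ^ 3) measure.
        sets \<mu> = sets (restrict_space borel S2) \<and> finite_measure \<mu> \<and>
        (\<forall>r\<le>N. \<forall>c\<le>N.
           integrable \<mu> (\<lambda>\<Omega>. ket_bra (coherent_state N \<Omega>) $$ (r, c)) \<and>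
           \<rho> $$ (r, c) = complex_of_real (real (N + 1) / (4 * pi)) *
             (\<integral>\<Omega>. ket_bra (coherent_state N \<Omega>) $$ (r, c) \<partial>\<mu>)))"

definition SAS :: "nat \<Rightarrow> complex mat set" where
  "SAS N = {\<rho>. spin_state N \<rho> \<and> (\<forall>U\<in>SU (N + 1). admits_positive_P N (conj_by U \<rho>))}"

end

theory Submission
  imports Defs
begin

text \<open>
  Both witnesses are rank-one perturbations of a multiple of the identity: \<open>\<rho> = diag (1, 3, 3) / 7\<close> and
  \<open>\<sigma> = diag (6, 13, 6) / 25\<close>.

  The kernel eigenvalues are about \<open>1.57, -0.72, 0.15\<close>. As \<open>\<rho> = 3/7 - 2/7 |1,1\<rangle>\<langle>1,1|\<close> and the
  largest one exceeds \<open>3/2\<close>, the Wigner function of \<open>\<rho>\<close> is negative at the North pole. As a unitary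
  conjugate of \<open>\<sigma>\<close> is \<open>6/25 + 7/25 |\<phi>\<rangle>\<langle>\<phi>|\<close> and the smallest one is above \<open>-3/4\<close>, the Wigner
  function of that conjugate is at least \<open>6/25 - 21/100 > 0\<close>.

  The projector onto the coherent state at \<open>w\<close> is a quadratic polynomial in \<open>w\<close>, so a state is
  a mixture of coherent states iff suitable first and second moments are those of a probability
  measure on the sphere. On coherent states the population of \<open>|1,0\<rangle>\<close> is at most \<open>1/2\<close>, which
  excludes \<open>\<sigma>\<close>. For \<open>3/7 - 2/7 |\<phi>\<rangle>\<langle>\<phi>|\<close>, write \<open>\<phi>\<close> in the Cartesian basis as \<open>p + i q\<close>, with the
  phase chosen so that \<open>p \<bullet> q = 0\<close>. The moments required are \<open>- 4/7 p \<times> q\<close> and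
  \<open>1/7 + 4/7 (p p\<^sup>T + q q\<^sup>T)\<close>; they are realised by the eight points \<open>(\<plusminus>a, \<plusminus>b, \<plusminus>c)\<close> in an orthonormal
  frame along \<open>p, q, p \<times> q\<close>, with weights depending only on the last sign.
\<close>

subsection \<open>Coherent projectors\<close>

lemma lessThan_3: "{0..<3::nat} = {0, 1, 2}" "{..<3::nat} = {0, 1, 2}"
  by auto

lemma adjoint_mult_of_unitary:
  assumes "U \<in> carrier_mat n n" "U * mat_adjoint U = 1\<^sub>m n"
  shows "mat_adjoint U * U = 1\<^sub>m n"
proof -
  have "mat_adjoint U \<in> carrier_mat n n"
    using assms(1) by (auto simp: mat_adjoint_simps)
  then show ?thesis using mat_mult_left_right_inverse[OF assms(1)] assms(2) by blast
qed

text \<open>Orthogonality to the first column and determinant 1 form a linear system for the second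
  column. Its determinant is |a|^2 + |b|^2 = 1, so multiplying an unknown by this sum solves for
  it.\<close>

lemma SU2_cases:
  assumes "g \<in> SU 2"
  obtains a b where "a * cnj a + b * cnj b = 1"
    "g $$ (0,0) = a" "g $$ (1,0) = b" "g $$ (0,1) = - cnj b" "g $$ (1,1) = cnj a"
proof -
  define a b c d where abcd: "a = g $$ (0,0)" "b = g $$ (1,0)" "c = g $$ (0,1)" "d = g $$ (1,1)"
  have g: "g \<in> carrier_mat 2 2" and u: "g * mat_adjoint g = 1\<^sub>m 2" and d: "det g = 1"
    using assms by (auto simp: SU_def)
  have two: "{0..<2::nat} = {0, 1}" by auto
  have dim: "dim_row g = 2" "dim_col g = 2" using g by auto
  have u': "mat_adjoint g * g = 1\<^sub>m 2" using adjoint_mult_of_unitary[OF g u] .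
  have ent: "(mat_adjoint g * g) $$ (i,j) = cnj (g $$ (0,i)) * g $$ (0,j) + cnj (g $$ (1,i)) * g $$ (1,j)"
    if "i < 2" "j < 2" for i j
    using that by (simp add: dim mat_adjoint_simps scalar_prod_def two)
  have 1: "a * cnj a + b * cnj b = 1" using ent[of 0 0] by (simp add: u' abcd mult.commute)
  have 2: "cnj a * c + cnj b * d = 0" using ent[of 0 1] by (simp add: u' abcd)
  have 3: "a * d - c * b = 1"
    using d by (simp add: laplace_expansion_column[OF g, of 0] cofactor_def mat_delete_def
        det_single two dim abcd lessThan_atLeast0 algebra_simps)
  have "d = (a * cnj a + b * cnj b) * d" using 1 by simp
  also have "\<dots> = cnj a * (a * d - c * b) + b * (cnj a * c + cnj b * d)" by (simp add: algebra_simps)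
  finally have "d = cnj a" using 2 3 by simp
  have "c = (a * cnj a + b * cnj b) * c" using 1 by simp
  also have "\<dots> = a * (cnj a * c + cnj b * d) - cnj b * (a * d - c * b)" by (simp add: algebra_simps)
  finally have "c = - cnj b" using 2 3 by simp
  with \<open>d = cnj a\<close> show ?thesis using that 1 abcd by metis
qed

lemma pauli_entries:
  "pauli w $$ (0,0) = of_real (w $ 3)" "pauli w $$ (0,1) = Complex (w $ 1) (- (w $ 2))"
  "pauli w $$ (1,0) = Complex (w $ 1) (w $ 2)" "pauli w $$ (1,1) = - of_real (w $ 3)"
  "dim_row (pauli w) = 2" "dim_col (pauli w) = 2"
  by (simp_all add: pauli_def mat_of_rows_list_def)

text \<open>Since \<open>rotor\<close> is an arbitrary choice, \<Omega> is tied to the spinor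
  \<open>(a, b)\<close> through the first row of
  \<open>conj_by g (pauli north) = pauli \<Omega>\<close>. This is the Hopf map.\<close>

lemma rotor_cases:
  assumes "\<Omega> \<in> S2"
  obtains a b where "a * cnj a + b * cnj b = 1"
    "rotor \<Omega> $$ (0,0) = a" "rotor \<Omega> $$ (1,0) = b"
    "rotor \<Omega> $$ (0,1) = - cnj b" "rotor \<Omega> $$ (1,1) = cnj a"
    "complex_of_real (\<Omega> $ 3) = a * cnj a - b * cnj b"
    "Complex (\<Omega> $ 1) (- (\<Omega> $ 2)) = 2 * a * cnj b"
proof -
  define g where "g = rotor \<Omega>"
  have g: "g \<in> SU 2" and r: "conj_by g (pauli north) = pauli \<Omega>"
    using rotates_north_to_rotor[OF assms] by (auto simp: rotates_north_to_def g_def)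
  obtain a b where ab: "a * cnj a + b * cnj b = 1"
    "g $$ (0,0) = a" "g $$ (1,0) = b" "g $$ (0,1) = - cnj b" "g $$ (1,1) = cnj a"
    using SU2_cases[OF g] .
  have two: "{0..<2::nat} = {0, 1}" by auto
  have dim: "dim_row g = 2" "dim_col g = 2" using g by (auto simp: SU_def)
  have nz: "Complex 0 0 = 0" "Complex 0 (- 0) = 0" by (simp_all add: complex_eq_iff)
  have "conj_by g (pauli north) $$ (0,0) = a * cnj a - b * cnj b"
    "conj_by g (pauli north) $$ (0,1) = 2 * a * cnj b"
    using ab by (simp_all add: conj_by_def dim pauli_entries[unfolded One_nat_def] nz axis3_simps north_def mat_adjoint_simps
        scalar_prod_def two)
  with that[of a b] ab r show ?thesis by (simp add: pauli_entries[unfolded One_nat_def] g_def)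
qed

lemma spin_rep_2_entries:
  fixes a b c d :: complex
  assumes "g $$ (0,0) = a" "g $$ (1,0) = b" "g $$ (0,1) = c" "g $$ (1,1) = d"
  shows "spin_rep 2 g = mat_of_rows_list 3
    [[a\<^sup>2, sqrt 2 * a * c, c\<^sup>2],
     [sqrt 2 * a * b, a * d + b * c, sqrt 2 * c * d],
     [b\<^sup>2, sqrt 2 * b * d, d\<^sup>2]]"
proof -
  \<comment> \<open>In the outer columns of the middle row the normalisation
    \<open>sqrt (1/2)\<close> meets the binomial coefficient 2 of a squared linear form.\<close>
  have s: "complex_of_real (sqrt (1/2)) * 2 = complex_of_real (sqrt 2)"
     "complex_of_real (sqrt 2) * complex_of_real (sqrt 2) = 2"
    by (simp_all add: real_sqrt_divide field_simps flip: of_real_mult)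
  show ?thesis
    by (rule eq_matI)
     (use assms s in \<open>auto simp: spin_rep_def mat_of_rows_list_def less_Suc_eq numeral_3_eq_3 numeral_2_eq_2
        coeff_mult algebra_simps\<close>)
qed

text \<open>The coherent projector as a polynomial in the coordinates of \<open>w\<close>, free of
  the choice made in \<open>rotor\<close>. It has this meaning only on the sphere; being defined
  everywhere, it is continuous and hence Borel on the whole space.\<close>

definition spin1_projector :: "real ^ 3 \<Rightarrow> complex mat" where
  "spin1_projector w = (let u = Complex (w $ 1) (- (w $ 2)); z = complex_of_real (w $ 3); s = complex_of_real (sqrt 2) in
    mat_of_rows_list 3
    [[(1 + z)\<^sup>2 / 4, s * (1 + z) * u / 4, u\<^sup>2 / 4],
     [s * (1 + z) * cnj u / 4, (1 - z\<^sup>2) / 2, s * (1 - z) * u / 4],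
     [(cnj u)\<^sup>2 / 4, s * (1 - z) * cnj u / 4, (1 - z)\<^sup>2 / 4]])"

text \<open>The coherent state is the symmetric square of the spinor \<open>(a, b)\<close>, so its
  projector depends only on the products |a|^2, |b|^2 and \<open>a * cnj b\<close>, which the Hopf
  map expresses by \<Omega>.\<close>

lemma ket_bra_coherent_state:
  assumes "\<Omega> \<in> S2"
  shows "ket_bra (coherent_state 2 \<Omega>) = spin1_projector \<Omega>"
proof -
  obtain a b where ab: "a * cnj a + b * cnj b = 1"
    "rotor \<Omega> $$ (0,0) = a" "rotor \<Omega> $$ (1,0) = b"
    "rotor \<Omega> $$ (0,1) = - cnj b" "rotor \<Omega> $$ (1,1) = cnj a"
    "complex_of_real (\<Omega> $ 3) = a * cnj a - b * cnj b"
    "Complex (\<Omega> $ 1) (- (\<Omega> $ 2)) = 2 * a * cnj b"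
    using rotor_cases[OF assms] .
  define s where "s = complex_of_real (sqrt 2)"
  have s: "s * s = 2" "s * (s * x) = 2 * x" for x
    by (simp_all add: s_def mult.assoc[symmetric] flip: of_real_mult)
  have cs: "cnj s = s" by (simp add: s_def)
  have coh: "coherent_state 2 \<Omega> = vec_of_list [a\<^sup>2, s * a * b, b\<^sup>2]"
    by (rule eq_vecI) (auto simp: coherent_state_def s_def
        spin_rep_2_entries[OF ab(2-5)] mat_of_rows_list_def less_Suc_eq numeral_3_eq_3 vec_of_list_index)
  have z: "1 + complex_of_real (\<Omega> $ 3) = 2 * a * cnj a" "1 - complex_of_real (\<Omega> $ 3) = 2 * b * cnj b"
    unfolding ab(6) by (simp_all flip: ab(1))
  have z2: "1 - (complex_of_real (\<Omega> $ 3))\<^sup>2 = 4 * a * cnj a * b * cnj b"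
  proof -
    have "1 - (complex_of_real (\<Omega> $ 3))\<^sup>2 = (1 + complex_of_real (\<Omega> $ 3)) * (1 - complex_of_real (\<Omega> $ 3))"
      by (simp add: power2_eq_square algebra_simps)
    then show ?thesis by (simp add: z)
  qed
  show ?thesis
    by (rule eq_matI)
     (auto simp: ket_bra_def coh spin1_projector_def Let_def mat_of_rows_list_def less_Suc_eq numeral_3_eq_3
        vec_of_list_index ab(7) z z2[unfolded power2_eq_square] z2 s s_def[symmetric] cs power2_eq_square mult_ac)
qed

lemma spin_rep_rotor_unitary:
  assumes "\<Omega> \<in> S2"
  shows "spin_rep 2 (rotor \<Omega>) * mat_adjoint (spin_rep 2 (rotor \<Omega>)) = 1\<^sub>m 3"
proof -
  obtain a b where ab: "a * cnj a + b * cnj b = 1"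
    "rotor \<Omega> $$ (0,0) = a" "rotor \<Omega> $$ (1,0) = b"
    "rotor \<Omega> $$ (0,1) = - cnj b" "rotor \<Omega> $$ (1,1) = cnj a"
    using rotor_cases[OF assms] by metis
  define s where "s = complex_of_real (sqrt 2)"
  have s: "s * s = 2" "s * (s * x) = 2 * x" for x
    by (simp_all add: s_def mult.assoc[symmetric] flip: of_real_mult)
  have cs: "cnj s = s" by (simp add: s_def)
  \<comment> \<open>With names for the conjugates, unitarity becomes a set of polynomial identities
    in \<open>a\<close>, \<open>b\<close>, \<open>A\<close>, \<open>B\<close>.\<close>
  define A B where "A = cnj a" and "B = cnj b"
  have e: "a * A + b * B = 1" "cnj A = a" "cnj B = b" using ab by (simp_all add: A_def B_def)
  define V where "V = spin_rep 2 (rotor \<Omega>)"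
  have V: "V = mat_of_rows_list 3
    [[a\<^sup>2, - (s * a * B), B\<^sup>2],
     [s * a * b, a * A - b * B, - (s * B * A)],
     [b\<^sup>2, s * b * A, A\<^sup>2]]"
    unfolding V_def spin_rep_2_entries[OF ab(2-5)] by (simp add: A_def B_def s_def)
  have dim: "dim_row V = 3" "dim_col V = 3" by (simp_all add: V mat_of_rows_list_def)
  have ent: "V $$ (0,0) = a\<^sup>2" "V $$ (0,1) = - (s * a * B)" "V $$ (0,2) = B\<^sup>2"
   "V $$ (1,0) = s * a * b" "V $$ (1,1) = a * A - b * B" "V $$ (1,2) = - (s * B * A)"
   "V $$ (2,0) = b\<^sup>2" "V $$ (2,1) = s * b * A" "V $$ (2,2) = A\<^sup>2"
    by (simp_all add: V mat_of_rows_list_def)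
  have "V * mat_adjoint V = 1\<^sub>m 3"
  proof (rule eq_matI)
    fix i j assume "i < dim_row (1\<^sub>m 3 :: complex mat)" "j < dim_col (1\<^sub>m 3 :: complex mat)"
    then have ij: "i \<in> {0,1,2}" "j \<in> {0,1,2}" by auto
    have *: "(V * mat_adjoint V) $$ (i,j) = (\<Sum>k\<in>{0,1,2}. V $$ (i,k) * cnj (V $$ (j,k)))"
      using ij by (auto simp: dim mat_adjoint_simps scalar_prod_def lessThan_3)
    \<comment> \<open>Each diagonal entry of \<open>V * mat_adjoint V\<close> reduces to this square
      of |a|^2 + |b|^2 = 1; the off-diagonal entries cancel identically.\<close>
    have q: "a\<^sup>2 * A\<^sup>2 + 2 * (a * A * b * B) + b\<^sup>2 * B\<^sup>2 = 1"
      using arg_cong[OF e(1), of "\<lambda>x. x\<^sup>2"] by (simp add: power2_eq_square algebra_simps)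
    have cA: "cnj a = A" "cnj b = B" by (simp_all add: A_def B_def)
    show "(V * mat_adjoint V) $$ (i,j) = 1\<^sub>m 3 $$ (i,j)"
      unfolding * using ij q
      by (auto simp: ent[unfolded One_nat_def] ent e(2,3) cA cs s power2_eq_square algebra_simps)
  qed (simp_all add: dim mat_adjoint_simps)
  then show ?thesis by (simp add: V_def)
qed

lemma mtrace_mult_commute:
  assumes "A \<in> carrier_mat n m" "B \<in> carrier_mat m n"
  shows "mtrace (A * B) = mtrace (B * A)"
proof -
  have "mtrace (A * B) = (\<Sum>i<n. \<Sum>j<m. A $$ (i,j) * B $$ (j,i))"
    using assms by (auto simp: mtrace_def scalar_prod_def atLeast0LessThan intro!: sum.cong)
  also have "\<dots> = (\<Sum>j<m. \<Sum>i<n. B $$ (j,i) * A $$ (i,j))"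
    by (subst sum.swap) (simp add: mult.commute)
  also have "\<dots> = mtrace (B * A)"
    using assms by (auto simp: mtrace_def scalar_prod_def atLeast0LessThan intro!: sum.cong)
  finally show ?thesis .
qed

subsection \<open>Wigner functions\<close>

text \<open>The index set of Racah's sum becomes an interval with a conditional, which can be
  expanded term by term for each \<open>L\<close>.\<close>

lemma clebsch_gordan_spin1:
  assumes "\<bar>m\<bar> \<le> 2" "even m" "L \<le> 2"
  shows "clebsch_gordan 2 m (2 * int L) 0 2 m =
       sqrt (3 * hfact (4 - 2 * int L) * hfact (2 * int L) * hfact (2 * int L)
             / hfact (6 + 2 * int L)) *
       sqrt (hfact (2 + m) * hfact (2 - m) * hfact (2 - m) * hfact (2 + m)
             * hfact (2 * int L) * hfact (2 * int L)) *
       (\<Sum>k = 0..L. if 2 * int k \<le> 2 - m \<and> 2 * int L \<le> 2 + m + 2 * int k then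
          (- 1) ^ k / (fact k * hfact (2 * int L - 2 * int k) * hfact (2 - m - 2 * int k)
           * hfact (2 * int L - 2 * int k) * hfact (2 - 2 * int L + m + 2 * int k)
           * hfact (2 * int k)) else 0)"
proof -
  have *: "{k::nat. 2 * int k \<le> 2 + 2 * int L - 2 \<and> 2 * int k \<le> 2 - m \<and> 2 * int k \<le> 2 * int L + 0 \<and>
     0 \<le> 2 - 2 * int L + m + 2 * int k \<and> 0 \<le> (2::int) - 2 - 0 + 2 * int k}
   = {k \<in> {0..L}. 2 * int k \<le> 2 - m \<and> 2 * int L \<le> 2 + m + 2 * int k}"
    by auto
  show ?thesis
    unfolding clebsch_gordan_def * sum.inter_filter[OF finite_atLeastAtMost]
    using assms by (simp cong: if_cong)
qed

lemma kernel_eigenvalue_2: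
  "kernel_eigenvalue 2 2 = 1/3 + 1 / sqrt 2 + sqrt 10 / 6"
  "kernel_eigenvalue 2 0 = 1/3 - sqrt 10 / 3"
  "kernel_eigenvalue 2 (-2) = 1/3 - 1 / sqrt 2 + sqrt 10 / 6"
proof -
  have sum3: "(\<Sum>L = 0..2. f L) = f 0 + f 1 + f 2" for f :: "nat \<Rightarrow> real"
    by (simp add: numeral_2_eq_2)
  have e: "kernel_eigenvalue 2 m =
    (clebsch_gordan 2 m (2 * int 0) 0 2 m + 3 * clebsch_gordan 2 m (2 * int 1) 0 2 m
      + 5 * clebsch_gordan 2 m (2 * int 2) 0 2 m) / 3" for m
    unfolding kernel_eigenvalue_def sum3 by (simp add: field_simps)
  have two: "{0..2::nat} = {0,1,2}" by auto
  \<comment> \<open>The first square root in Racah's formula is that of 3/24 = 1/8 for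
    \<open>L = 1\<close> and of 12/120 = 1/10 for \<open>L = 2\<close>.\<close>
  have "sqrt 8 = 2 * sqrt 2" using real_sqrt_mult[of 4 2] by simp
  then have s: "sqrt (1 / 8) * 2 = 1 / sqrt 2" "sqrt (1 / 10) * 10 = sqrt 10" "10 * sqrt (1 / 10) = sqrt 10"
    by (simp_all add: real_sqrt_divide real_div_sqrt)
  have p: "clebsch_gordan 2 2 (2 * int 0) 0 2 2 = 1" "clebsch_gordan 2 2 (2 * int 1) 0 2 2 = 1 / sqrt 2" "clebsch_gordan 2 2 (2 * int 2) 0 2 2 = sqrt 10 / 10"
    by (subst clebsch_gordan_spin1, simp, simp, simp, simp add: hfact_def fact_numeral sum.atLeast0_atMost_Suc two s)+
  have z: "clebsch_gordan 2 0 (2 * int 0) 0 2 0 = 1" "clebsch_gordan 2 0 (2 * int 1) 0 2 0 = 0" "clebsch_gordan 2 0 (2 * int 2) 0 2 0 = - sqrt 10 / 5"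
    by (subst clebsch_gordan_spin1, simp, simp, simp, simp add: hfact_def fact_numeral sum.atLeast0_atMost_Suc two s)+
  have m: "clebsch_gordan 2 (-2) (2 * int 0) 0 2 (-2) = 1" "clebsch_gordan 2 (-2) (2 * int 1) 0 2 (-2) = - 1 / sqrt 2" "clebsch_gordan 2 (-2) (2 * int 2) 0 2 (-2) = sqrt 10 / 10"
    by (subst clebsch_gordan_spin1, simp, simp, simp, simp add: hfact_def fact_numeral sum.atLeast0_atMost_Suc two s)+
  show "kernel_eigenvalue 2 2 = 1/3 + 1 / sqrt 2 + sqrt 10 / 6"
    unfolding e p by simp
  show "kernel_eigenvalue 2 0 = 1/3 - sqrt 10 / 3"
    unfolding e z by simp
  show "kernel_eigenvalue 2 (-2) = 1/3 - 1 / sqrt 2 + sqrt 10 / 6"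
    unfolding e m by simp
qed

section \<open>Wigner functions of unitary conjugates of diagonal states\<close>

lemma conj_by_diag_entry:
  assumes "X \<in> carrier_mat n n" "i < n" "j < n"
  shows "conj_by X (mat_diag n r) $$ (i, j) = (\<Sum>k<n. X $$ (i,k) * r k * cnj (X $$ (j,k)))"
  using assms by (auto simp: conj_by_def mat_diag_mult_right[OF assms(1)] mat_adjoint_simps scalar_prod_def
      lessThan_atLeast0 intro!: sum.cong)

lemma unitary_row_sum:
  assumes "X \<in> carrier_mat n n" "X * mat_adjoint X = 1\<^sub>m n" "i < n"
  shows "(\<Sum>k<n. (cmod (X $$ (i,k)))\<^sup>2) = 1"
proof -
  have "(X * mat_adjoint X) $$ (i,i) = (\<Sum>k<n. X $$ (i,k) * cnj (X $$ (i,k)))"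
    using assms(1,3) by (auto simp: mat_adjoint_simps scalar_prod_def lessThan_atLeast0 intro!: sum.cong)
  also have "\<dots> = of_real (\<Sum>k<n. (cmod (X $$ (i,k)))\<^sup>2)"
    by (simp flip: complex_norm_square)
  finally have "of_real (\<Sum>k<n. (cmod (X $$ (i,k)))\<^sup>2) = (1::complex)"
    using assms by simp
  then show ?thesis by (simp only: of_real_eq_1_iff)
qed

lemma mat_adjoint_mat_adjoint: "mat_adjoint (mat_adjoint A) = (A :: complex mat)"
  by (rule eq_matI) (auto simp: mat_adjoint_simps)

lemma mat_adjoint_one: "mat_adjoint (1\<^sub>m n) = (1\<^sub>m n :: complex mat)"
  by (rule eq_matI) (auto simp: mat_adjoint_simps)

lemma mat_adjoint_mult:
  fixes A B :: "complex mat"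
  assumes "A \<in> carrier_mat n m" "B \<in> carrier_mat m l"
  shows "mat_adjoint (A * B) = mat_adjoint B * mat_adjoint A"
  using assms by (intro eq_matI)
    (auto simp: mat_adjoint_simps scalar_prod_def mult.commute intro!: sum.cong)

lemma unitary_column_sum:
  assumes "X \<in> carrier_mat n n" "X * mat_adjoint X = 1\<^sub>m n" "k < n"
  shows "(\<Sum>i<n. (cmod (X $$ (i,k)))\<^sup>2) = 1"
proof -
  have "(\<Sum>i<n. (cmod (mat_adjoint X $$ (k,i)))\<^sup>2) = 1"
    using assms by (intro unitary_row_sum)
      (auto simp: mat_adjoint_simps mat_adjoint_mat_adjoint adjoint_mult_of_unitary[OF assms(1,2)])
  then show ?thesis using assms by (simp add: mat_adjoint_simps)
qed

text \<open>Cyclicity of the trace moves the adjoint of the rotation to the front, where it merges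
  with \<open>U\<close> into \<open>X\<close>. What remains pairs the two spectra through the
  squared moduli of \<open>X\<close>, a doubly stochastic matrix when \<open>X\<close> is
  unitary.\<close>

lemma wigner_conj_diag:
  assumes U: "U \<in> carrier_mat (N+1) (N+1)"
    and X_def: "X = mat_adjoint (spin_rep N (rotor \<Omega>)) * U"
  shows "wigner N (conj_by U (mat_diag (N+1) (\<lambda>k. of_real (r k)))) \<Omega> =
    (\<Sum>i<N+1. \<Sum>k<N+1. (cmod (X $$ (i,k)))\<^sup>2 * r k * kernel_eigenvalue N (int N - 2 * int i))"
proof -
  define n where "n = N + 1"
  define V where "V = spin_rep N (rotor \<Omega>)"
  note X_def = X_def[folded V_def]
  define D where "D = mat_diag n (\<lambda>i. complex_of_real (kernel_eigenvalue N (int N - 2 * int i)))"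
  define R where "R = mat_diag n (\<lambda>k. complex_of_real (r k))"
  have V: "V \<in> carrier_mat n n" by (simp add: V_def spin_rep_def n_def)
  have U: "U \<in> carrier_mat n n" using U by (simp add: n_def)
  have V': "mat_adjoint V \<in> carrier_mat n n" and U': "mat_adjoint U \<in> carrier_mat n n"
    using U V by (auto simp: mat_adjoint_simps)
  have D: "D \<in> carrier_mat n n" and R: "R \<in> carrier_mat n n" by (auto simp: D_def R_def)
  have X: "X \<in> carrier_mat n n" using V' U by (auto simp: X_def)
  then have X': "mat_adjoint X \<in> carrier_mat n n" by (auto simp: mat_adjoint_simps)
  have XA: "mat_adjoint X = mat_adjoint U * V"
    unfolding X_def by (simp add: mat_adjoint_mult[OF V' U] mat_adjoint_mat_adjoint)
  note [simp] = V U V' U' D R X mult_carrier_mat[of _ n n _ n]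
  have "mtrace (conj_by U R * conj_by V D) = mtrace ((U * R * mat_adjoint U * V * D) * mat_adjoint V)"
    by (simp add: conj_by_def assoc_mult_mat[of _ n n _ n _ n])
  also have "\<dots> = mtrace (mat_adjoint V * (U * R * mat_adjoint U * V * D))"
    by (rule mtrace_mult_commute[of _ n n]) simp_all
  also have "\<dots> = mtrace (conj_by X R * D)"
    unfolding conj_by_def XA by (simp add: X_def assoc_mult_mat[of _ n n _ n _ n])
  also have "\<dots> = (\<Sum>i<n. \<Sum>k<n. X $$ (i,k) * of_real (r k) * cnj (X $$ (i,k)) * of_real (kernel_eigenvalue N (int N - 2 * int i)))"
  proof -
    have c: "conj_by X R \<in> carrier_mat n n" using X' unfolding conj_by_def by simp
    show ?thesis
      unfolding mtrace_def D_def mat_diag_mult_right[OF c]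
      using c X by (auto simp: R_def conj_by_diag_entry sum_distrib_right intro!: sum.cong)
  qed
  also have "\<dots> = of_real (\<Sum>i<n. \<Sum>k<n. (cmod (X $$ (i,k)))\<^sup>2 * r k * kernel_eigenvalue N (int N - 2 * int i))"
    by (simp add: complex_norm_square mult_ac del: of_real_power)
  finally show ?thesis
    unfolding wigner_def wigner_kernel_def V_def[symmetric] D_def R_def n_def by simp
qed

lemma spin_state_diag:
  assumes "\<And>i. i \<le> N \<Longrightarrow> 0 \<le> r i" "(\<Sum>i\<le>N. r i) = 1"
  shows "spin_state N (mat_diag (N+1) (\<lambda>k. complex_of_real (r k)))"
proof -
  let ?A = "mat_diag (N+1) (\<lambda>k. complex_of_real (r k))"
  have "(?A *\<^sub>v v) \<bullet>c v = of_real (\<Sum>i\<le>N. r i * (cmod (vec_index v i))\<^sup>2)"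
    if v: "v \<in> carrier_vec (N+1)" for v
  proof -
    have "vec_index (?A *\<^sub>v v) i = of_real (r i) * vec_index v i" if "i < N + 1" for i
      using that v by (simp add: mult_mat_vec_def scalar_prod_def mat_diag_def if_distrib[of "\<lambda>x. x * _"]
         sum.delta cong: if_cong)
    then show ?thesis using v
      by (simp add: scalar_prod_def complex_norm_square mult.assoc atLeast0LessThan lessThan_Suc_atMost
          del: of_real_power)
  qed
  then have "psd ?A" using assms(1)
    unfolding psd_def by (auto simp: mat_diag_def intro!: sum_nonneg mult_nonneg_nonneg simp del: of_real_power)
  moreover have "mtrace ?A = of_real (\<Sum>i\<le>N. r i)"
    by (simp add: mtrace_def mat_diag_def lessThan_Suc_atMost)
  ultimately show ?thesis by (simp add: spin_state_def assms(2))
qed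

text \<open>Unitarity of \<open>X\<close> enters twice. The row sums, with kernel trace 1, turn the
  multiple of the identity into 6/25; the sum of column 1 turns the rank-one part into 7/25 times a
  convex combination of kernel eigenvalues.\<close>

lemma spin1_wigner_nonneg:
  assumes U: "U \<in> SU 3" and \<Omega>: "\<Omega> \<in> S2"
  shows "0 \<le> wigner 2 (conj_by U (mat_diag 3 (\<lambda>k. complex_of_real (if k = 1 then 13/25 else 6/25)))) \<Omega>"
proof -
  define V where "V = spin_rep 2 (rotor \<Omega>)"
  define X where "X = mat_adjoint V * U"
  define d where "d i = kernel_eigenvalue 2 (int 2 - 2 * int i)" for i
  define x where "x i k = (cmod (X $$ (i,k)))\<^sup>2" for i k
  have V: "V \<in> carrier_mat 3 3" "V * mat_adjoint V = 1\<^sub>m 3"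
    using spin_rep_rotor_unitary[OF \<Omega>] by (simp_all add: V_def spin_rep_def)
  have V': "mat_adjoint V \<in> carrier_mat 3 3" using V by (auto simp: mat_adjoint_simps)
  have U': "U \<in> carrier_mat 3 3" "U * mat_adjoint U = 1\<^sub>m 3" "mat_adjoint U \<in> carrier_mat 3 3"
    using U by (auto simp: SU_def mat_adjoint_simps)
  have X: "X \<in> carrier_mat 3 3" using V' U' by (auto simp: X_def)
  have "X * mat_adjoint X = mat_adjoint V * U * (mat_adjoint U * V)"
    by (simp add: X_def mat_adjoint_mult[OF V' U'(1)] mat_adjoint_mat_adjoint)
  also have "\<dots> = mat_adjoint V * (U * mat_adjoint U) * V"
    using V(1) V' U'(1,3) by (simp add: assoc_mult_mat[of _ 3 3 _ 3 _ 3] mult_carrier_mat[of _ 3 3 _ 3])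
  also have "\<dots> = 1\<^sub>m 3" using V' by (simp add: U' adjoint_mult_of_unitary[OF V])
  finally have XX: "X * mat_adjoint X = 1\<^sub>m 3" .
  have sum3: "(\<Sum>i<3. f i) = f 0 + f 1 + f 2" for f :: "nat \<Rightarrow> real" by (simp add: lessThan_3)
  have row: "x i 0 + x i 1 + x i 2 = 1" if "i < 3" for i
    using unitary_row_sum[OF X XX that] by (simp add: sum3 x_def)
  have col: "x 0 1 + x 1 1 + x 2 1 = 1"
    using unitary_column_sum[OF X XX, of 1] by (simp add: sum3 x_def)
  have d: "d 0 + d 1 + d 2 = 1" "- 3/4 \<le> d 0" "- 3/4 \<le> d 1" "- 3/4 \<le> d 2"
  proof -
    \<comment> \<open>The bound 13/4 is exactly what the smallest eigenvalue needs: 1/3 - 13/12 =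
      -3/4.\<close>
    have s: "sqrt 10 \<le> 13/4" by (rule real_le_lsqrt) (simp_all add: power2_eq_square)
    have t: "1 / sqrt 2 \<le> 1" "0 \<le> 1 / sqrt 2" by simp_all
    show "d 0 + d 1 + d 2 = 1" by (simp add: d_def kernel_eigenvalue_2)
    have u: "0 \<le> sqrt 10" by simp
    have d: "d 0 = 1/3 + 1 / sqrt 2 + sqrt 10 / 6" "d 1 = 1/3 - sqrt 10 / 3" "d 2 = 1/3 - 1 / sqrt 2 + sqrt 10 / 6"
      by (simp_all add: d_def kernel_eigenvalue_2)
    show "- 3/4 \<le> d 0" "- 3/4 \<le> d 1" "- 3/4 \<le> d 2" using s t u unfolding d by linarith+
  qed
  have "wigner 2 (conj_by U (mat_diag 3 (\<lambda>k. complex_of_real (if k = 1 then 13/25 else 6/25)))) \<Omega>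
     = (\<Sum>i<3. \<Sum>k<3. x i k * (if k = 1 then 13/25 else 6/25) * d i)"
    using wigner_conj_diag[of U 2 X \<Omega> "\<lambda>k. if k = 1 then 13/25 else 6/25"] U'(1)
    by (simp add: X_def V_def x_def d_def)
  also have "\<dots> = (\<Sum>i<3. (6/25 * (x i 0 + x i 1 + x i 2) + 7/25 * x i 1) * d i)"
    by (simp add: sum3 field_simps)
  also have "\<dots> = (\<Sum>i<3. (6/25 * 1 + 7/25 * x i 1) * d i)"
    by (intro sum.cong refl) (simp only: row lessThan_iff)
  also have "\<dots> = (\<Sum>i<3. 6/25 * d i) + 7/25 * (\<Sum>i<3. x i 1 * d i)"
    by (simp add: sum.distrib sum_distrib_left distrib_right mult.assoc)
  also have "\<dots> \<ge> 6/25 + 7/25 * (- 3/4)"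
  proof -
    have "(\<Sum>i<3. x i 1 * (- 3/4)) \<le> (\<Sum>i<3. x i 1 * d i)"
      unfolding sum3 by (intro add_mono mult_left_mono d) (simp_all add: x_def)
    moreover have "(\<Sum>i<3. x i 1 * (- 3/4)) = - 3/4"
      using col unfolding sum_distrib_right[symmetric] sum3 by simp
    moreover have "(\<Sum>i<3. 6/25 * d i) = 6/25" using d(1) unfolding sum3 by linarith
    ultimately show ?thesis by linarith
  qed
  finally show ?thesis by simp
qed

lemma spin1_wigner_negative:
  "wigner 2 (mat_diag 3 (\<lambda>k. complex_of_real (if k = 0 then 1/7 else 3/7))) north < 0"
proof -
  have n: "north \<in> S2" by (simp add: north_def)
  obtain a b where ab: "a * cnj a + b * cnj b = 1"
    "rotor north $$ (0,0) = a" "rotor north $$ (1,0) = b"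
    "rotor north $$ (0,1) = - cnj b" "rotor north $$ (1,1) = cnj a"
    "complex_of_real (north $ 3) = a * cnj a - b * cnj b"
    using rotor_cases[OF n] by metis
  \<comment> \<open>Whichever rotor is chosen at the North pole, it fixes the pole and is therefore
    diagonal. Its spin-1 image is a diagonal matrix of phases, so only the populations enter the
    Wigner function there.\<close>
  have "a * cnj a - b * cnj b = 1" using ab(6) by (simp add: north_def axis3_simps)
  have "2 * (b * cnj b) = (a * cnj a + b * cnj b) - (a * cnj a - b * cnj b)" by simp
  also have "\<dots> = 0" by (simp only: ab(1) \<open>a * cnj a - b * cnj b = 1\<close>) simp
  finally have b: "b = 0" by simp
  with ab(1) have "complex_of_real ((cmod a)\<^sup>2) = 1" by (simp only: complex_norm_square) simp
  then have "(cmod a)\<^sup>2 = 1" by (simp only: of_real_eq_1_iff)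
  then have a: "cmod a = 1" by (metis norm_ge_zero one_power2 power2_eq_imp_eq zero_le_one)
  define V where "V = spin_rep 2 (rotor north)"
  have V: "V = mat_of_rows_list 3 [[a\<^sup>2, 0, 0], [0, a * cnj a, 0], [0, 0, (cnj a)\<^sup>2]]"
    unfolding V_def spin_rep_2_entries[OF ab(2-5)] by (simp add: b)
  have sum3: "(\<Sum>i<3. f i) = f 0 + f 1 + f 2" for f :: "nat \<Rightarrow> real" by (simp add: lessThan_3)
  have V': "mat_adjoint V \<in> carrier_mat 3 3" by (auto simp: mat_adjoint_simps V mat_of_rows_list_def)
  have X: "(cmod (mat_adjoint V $$ (i,k)))\<^sup>2 = (if i = k then 1 else 0)" if "i \<in> {0,1,2}" "k \<in> {0,1,2}" for i k
    using that by (auto simp: mat_adjoint_simps V mat_of_rows_list_def norm_power norm_mult a)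
  have one: "conj_by (1\<^sub>m 3) (mat_diag 3 r) = mat_diag 3 r" for r :: "nat \<Rightarrow> complex"
    by (simp add: conj_by_def mat_adjoint_one left_mult_one_mat[of _ 3 3] right_mult_one_mat[of _ 3 3])
  have "wigner 2 (mat_diag 3 (\<lambda>k. complex_of_real (if k = 0 then 1/7 else 3/7))) north =
    (\<Sum>i<3. \<Sum>k<3. (cmod (mat_adjoint V $$ (i,k)))\<^sup>2 * (if k = 0 then 1/7 else 3/7) * kernel_eigenvalue 2 (int 2 - 2 * int i))"
    using wigner_conj_diag[of "1\<^sub>m 3" 2 "mat_adjoint V" north "\<lambda>k. if k = 0 then 1/7 else 3/7"] V'
    by (simp add: one V_def)
  also have "\<dots> = (kernel_eigenvalue 2 2 + 3 * kernel_eigenvalue 2 0 + 3 * kernel_eigenvalue 2 (- 2)) / 7"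
    unfolding sum3 by (simp add: X)
  also have "\<dots> = (7/3 - 2 * (1 / sqrt 2) - sqrt 10 / 3) / 7"
    unfolding kernel_eigenvalue_2 by (simp add: field_simps)
  also have "\<dots> < 0"
  proof -
    \<comment> \<open>These bounds make the bracket at most 7/3 - 7/5 - 1 = -1/15.\<close>
    have "7/5 \<le> sqrt 2" by (rule real_le_rsqrt) (simp add: power2_eq_square)
    moreover have "1 / sqrt 2 = sqrt 2 / 2" by (simp add: field_simps)
    moreover have "3 \<le> sqrt 10" by (rule real_le_rsqrt) simp
    ultimately show ?thesis by simp
  qed
  finally show ?thesis .
qed

subsection \<open>Positive P functions\<close>

lemma spin1_projector_measurable:
  assumes "r \<le> 2" "c \<le> 2"
  shows "(\<lambda>w. spin1_projector w $$ (r, c)) \<in> borel_measurable borel"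
proof -
  have "r \<in> {0,1,2}" "c \<in> {0,1,2}" using assms by auto
  then show ?thesis
    by (intro borel_measurable_continuous_onI)
      (auto simp: spin1_projector_def Let_def mat_of_rows_list_def intro!: continuous_intros)
qed

text \<open>The sigma-algebra of \<mu> forces its space to be the sphere, where both integrands
  agree pointwise. This trades \<open>rotor\<close>, of which no measurability is known, for a
  polynomial.\<close>

lemma admits_positive_P_2_iff:
  "admits_positive_P 2 \<rho> \<longleftrightarrow>
     (\<exists>\<mu> :: (real ^ 3) measure.
        sets \<mu> = sets (restrict_space borel S2) \<and> finite_measure \<mu> \<and>
        (\<forall>r\<le>2. \<forall>c\<le>2.
           integrable \<mu> (\<lambda>\<Omega>. spin1_projector \<Omega> $$ (r, c)) \<and>
           \<rho> $$ (r, c) = complex_of_real (3 / (4 * pi)) *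
             (\<integral>\<Omega>. spin1_projector \<Omega> $$ (r, c) \<partial>\<mu>)))"
proof -
  have *: "integrable \<mu> (\<lambda>\<Omega>. ket_bra (coherent_state 2 \<Omega>) $$ (r, c)) \<longleftrightarrow>
      integrable \<mu> (\<lambda>\<Omega>. spin1_projector \<Omega> $$ (r, c))"
    "(\<integral>\<Omega>. ket_bra (coherent_state 2 \<Omega>) $$ (r, c) \<partial>\<mu>) = (\<integral>\<Omega>. spin1_projector \<Omega> $$ (r, c) \<partial>\<mu>)"
    if "sets \<mu> = sets (restrict_space borel S2)" for \<mu> :: "(real ^ 3) measure" and r c
  proof -
    have "space \<mu> = S2" using sets_eq_imp_space_eq[OF that] by (simp add: space_restrict_space)
    then show "integrable \<mu> (\<lambda>\<Omega>. ket_bra (coherent_state 2 \<Omega>) $$ (r, c)) \<longleftrightarrow>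
      integrable \<mu> (\<lambda>\<Omega>. spin1_projector \<Omega> $$ (r, c))"
    "(\<integral>\<Omega>. ket_bra (coherent_state 2 \<Omega>) $$ (r, c) \<partial>\<mu>) = (\<integral>\<Omega>. spin1_projector \<Omega> $$ (r, c) \<partial>\<mu>)"
      by (auto intro!: Bochner_Integration.integrable_cong Bochner_Integration.integral_cong simp: ket_bra_coherent_state)
  qed
  show ?thesis
    unfolding admits_positive_P_def by (rule ex_cong1) (auto simp: *)
qed

text \<open>The measure is a finite sum of point masses, built as the image of a point measure on
  \<open>I\<close> under \<open>w\<close>, so that coinciding points simply add their weights. The
  factor \<open>4 * pi / 3\<close> cancels the normalisation of the P function.\<close>

lemma admits_positive_P_2_convex_combination:
  fixes w :: "'i \<Rightarrow> real ^ 3"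
  assumes I: "finite I" and t: "\<And>i. i \<in> I \<Longrightarrow> 0 \<le> t i" and w: "\<And>i. i \<in> I \<Longrightarrow> w i \<in> S2"
    and \<rho>: "\<And>r c. r \<le> 2 \<Longrightarrow> c \<le> 2 \<Longrightarrow>
      \<rho> $$ (r, c) = (\<Sum>i\<in>I. of_real (t i) * spin1_projector (w i) $$ (r, c))"
  shows "admits_positive_P 2 \<rho>"
proof -
  define f where "f i = 4 * pi / 3 * t i" for i
  have f: "0 \<le> f i" if "i \<in> I" for i using t[OF that] by (simp add: f_def)
  define \<nu> where "\<nu> = point_measure I (\<lambda>i. ennreal (f i))"
  define \<mu> where "\<mu> = distr \<nu> (restrict_space borel S2) w"
  have wm: "w \<in> measurable \<nu> (restrict_space borel S2)"
    using w by (auto simp: \<nu>_def space_restrict_space)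
  interpret \<nu>: finite_measure \<nu>
    by (rule finite_measureI) (use I in \<open>simp add: \<nu>_def space_point_measure emeasure_point_measure_finite\<close>)
  have "finite_measure \<mu>" unfolding \<mu>_def by (rule \<nu>.finite_measure_distr[OF wm])
  moreover have "sets \<mu> = sets (restrict_space borel S2)" by (simp add: \<mu>_def)
  moreover have "integrable \<mu> (\<lambda>\<Omega>. spin1_projector \<Omega> $$ (r, c)) \<and>
      \<rho> $$ (r, c) = complex_of_real (3 / (4 * pi)) * (\<integral>\<Omega>. spin1_projector \<Omega> $$ (r, c) \<partial>\<mu>)"
    if rc: "r \<le> 2" "c \<le> 2" for r c
  proof
    have m: "(\<lambda>\<Omega>. spin1_projector \<Omega> $$ (r, c)) \<in> borel_measurable (restrict_space borel S2)"
      by (rule measurable_restrict_space1[OF spin1_projector_measurable[OF rc]])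
    show "integrable \<mu> (\<lambda>\<Omega>. spin1_projector \<Omega> $$ (r, c))"
      using integrable_point_measure_finite[OF I] unfolding \<mu>_def by (subst integrable_distr_eq[OF wm m]) (simp only: \<nu>_def)
    have "(\<integral>\<Omega>. spin1_projector \<Omega> $$ (r, c) \<partial>\<mu>) = (\<Sum>i\<in>I. f i *\<^sub>R spin1_projector (w i) $$ (r, c))"
      using lebesgue_integral_point_measure_finite[OF I f] unfolding \<mu>_def
      by (subst integral_distr[OF wm m]) (simp only: \<nu>_def)
    then show "\<rho> $$ (r, c) = complex_of_real (3 / (4 * pi)) * (\<integral>\<Omega>. spin1_projector \<Omega> $$ (r, c) \<partial>\<mu>)"
      by (simp add: \<rho>[OF rc] f_def sum_distrib_left scaleR_conv_of_real field_simps)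
  qed
  ultimately show ?thesis unfolding admits_positive_P_2_iff by blast
qed

text \<open>A linear separability witness: on a coherent projector the difference of the two sides
  is the square of the third coordinate, and integration against a measure keeps it
  non-negative.\<close>

lemma middle_entry_le_of_admits_positive_P:
  assumes "admits_positive_P 2 \<rho>"
  shows "Re (\<rho> $$ (1, 1)) \<le> Re (\<rho> $$ (0, 0)) + Re (\<rho> $$ (2, 2))"
proof -
  from assms obtain \<mu> :: "(real ^ 3) measure" where
    int: "\<And>r c. r \<le> 2 \<Longrightarrow> c \<le> 2 \<Longrightarrow> integrable \<mu> (\<lambda>\<Omega>. spin1_projector \<Omega> $$ (r, c))" and
    \<rho>: "\<And>r c. r \<le> 2 \<Longrightarrow> c \<le> 2 \<Longrightarrow>
      \<rho> $$ (r, c) = complex_of_real (3 / (4 * pi)) * (\<integral>\<Omega>. spin1_projector \<Omega> $$ (r, c) \<partial>\<mu>)"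
    unfolding admits_positive_P_2_iff by blast
  have int': "integrable \<mu> (\<lambda>\<Omega>. Re (spin1_projector \<Omega> $$ (r, c)))" if "r \<le> 2" "c \<le> 2" for r c
    using int[OF that] by (rule integrable_Re)
  have \<rho>': "Re (\<rho> $$ (r, c)) = 3 / (4 * pi) * (\<integral>\<Omega>. Re (spin1_projector \<Omega> $$ (r, c)) \<partial>\<mu>)"
    if "r \<le> 2" "c \<le> 2" for r c
    unfolding \<rho>[OF that] integral_Re[OF int[OF that]] by (simp only: Re_complex_of_real Im_complex_of_real times_complex.sel mult_zero_left diff_0_right)
  have pt: "Re (spin1_projector \<Omega> $$ (0, 0)) + Re (spin1_projector \<Omega> $$ (2, 2)) - Re (spin1_projector \<Omega> $$ (1, 1)) = (\<Omega> $ 3)\<^sup>2"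
    for \<Omega>
    by (simp add: spin1_projector_def Let_def mat_of_rows_list_def power2_eq_square algebra_simps add_divide_distrib diff_divide_distrib)
  have "0 \<le> (\<integral>\<Omega>. Re (spin1_projector \<Omega> $$ (0, 0)) + Re (spin1_projector \<Omega> $$ (2, 2)) - Re (spin1_projector \<Omega> $$ (1, 1)) \<partial>\<mu>)"
    unfolding pt by simp
  also have "\<dots> = (\<integral>\<Omega>. Re (spin1_projector \<Omega> $$ (0, 0)) \<partial>\<mu>) + (\<integral>\<Omega>. Re (spin1_projector \<Omega> $$ (2, 2)) \<partial>\<mu>)
     - (\<integral>\<Omega>. Re (spin1_projector \<Omega> $$ (1, 1)) \<partial>\<mu>)"
    using int' by simp
  finally have "(\<integral>\<Omega>. Re (spin1_projector \<Omega> $$ (1, 1)) \<partial>\<mu>) \<le>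
    (\<integral>\<Omega>. Re (spin1_projector \<Omega> $$ (0, 0)) \<partial>\<mu>) + (\<integral>\<Omega>. Re (spin1_projector \<Omega> $$ (2, 2)) \<partial>\<mu>)"
    by linarith
  then have "3 / (4 * pi) * (\<integral>\<Omega>. Re (spin1_projector \<Omega> $$ (1, 1)) \<partial>\<mu>) \<le>
    3 / (4 * pi) * ((\<integral>\<Omega>. Re (spin1_projector \<Omega> $$ (0, 0)) \<partial>\<mu>) + (\<integral>\<Omega>. Re (spin1_projector \<Omega> $$ (2, 2)) \<partial>\<mu>))"
    by (rule mult_left_mono) simp
  moreover have "(0::nat) \<le> 2" "(1::nat) \<le> 2" "(2::nat) \<le> 2" by simp_all
  ultimately show ?thesis
    by (simp only: \<rho>' distrib_left)
qed

section \<open>Weighted points on the sphere with prescribed first and second moments\<close>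

no_notation scalar_prod (infix "\<bullet>" 70)

lemma orthonormal_frame_exists:
  fixes p q :: "real ^ 3"
  assumes "p \<noteq> 0" "p \<bullet> q = 0"
  obtains a b e1 e2 where "norm e1 = 1" "norm e2 = 1" "e1 \<bullet> e2 = 0" "p = a *\<^sub>R e1" "q = b *\<^sub>R e2"
proof -
  obtain y where y: "y \<noteq> 0" "Linear_Algebra.orthogonal p y" using orthogonal_to_vector_exists[of p] by auto
  define e1 where "e1 = p /\<^sub>R norm p"
  \<comment> \<open>If \<open>q = 0\<close>, any unit vector orthogonal to \<open>p\<close>
    completes the frame, with coefficient \<open>b = 0\<close>.\<close>
  define e2 where "e2 = (if q = 0 then y /\<^sub>R norm y else q /\<^sub>R norm q)"
  show ?thesis
    by (rule that[of e1 e2 "norm p" "norm q"])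
      (use assms y in \<open>auto simp: e1_def e2_def Linear_Algebra.orthogonal_def\<close>)
qed

text \<open>Orthonormality of the frame says that the matrix \<open>A\<close> with these rows
  satisfies \<open>A ** transpose A = 1\<close>. For a square matrix the product in the other order
  is then also the identity, and this is the completeness relation.\<close>

lemma cross3_frame_completeness:
  fixes e1 e2 :: "real ^ 3"
  assumes "norm e1 = 1" "norm e2 = 1" "e1 \<bullet> e2 = 0"
  shows "norm (cross3 e1 e2) = 1"
    "e1 $ i * e1 $ j + e2 $ i * e2 $ j + cross3 e1 e2 $ i * cross3 e1 e2 $ j = (if i = j then 1 else 0)"
proof -
  have "(norm (cross3 e1 e2))\<^sup>2 = 1" using norm_cross_dot[of e1 e2] assms by simp
  then show n: "norm (cross3 e1 e2) = 1"
    by (metis norm_ge_zero one_power2 power2_eq_imp_eq zero_le_one)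
  define A :: "real ^ 3 ^ 3" where "A = vector [e1, e2, cross3 e1 e2]"
  have A: "A $ 1 = e1" "A $ 2 = e2" "A $ 3 = cross3 e1 e2" by (simp_all add: A_def)
  have "A ** transpose A = Finite_Cartesian_Product.mat 1"
    using assms n by (simp add: Finite_Cartesian_Product.vec_eq_iff matrix_matrix_mult_def inner_vec_def[symmetric]
        Finite_Cartesian_Product.transpose_def Finite_Cartesian_Product.mat_def forall_3 A norm_eq_1 dot_cross_self
        inner_commute inner_real_def[symmetric] del: inner_real_def)
  then have "transpose A ** A = Finite_Cartesian_Product.mat 1" by (simp add: matrix_left_right_inverse)
  then have "(transpose A ** A) $ i $ j = Finite_Cartesian_Product.mat 1 $ i $ j" by simp
  then show "e1 $ i * e1 $ j + e2 $ i * e2 $ j + cross3 e1 e2 $ i * cross3 e1 e2 $ j = (if i = j then 1 else 0)"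
    by (simp add: matrix_matrix_mult_def Finite_Cartesian_Product.transpose_def sum_3 A Finite_Cartesian_Product.mat_def)
qed

text \<open>Symmetry under the first two signs removes all mixed second moments and the first
  moments along \<open>e1\<close> and \<open>e2\<close>; the biased third sign leaves a first moment
  along \<open>e3\<close>. The condition \<open>3 * \<alpha> + \<beta> = 1\<close> puts the points
  on the unit sphere, and \<open>\<beta>\<^sup>2 \<le> 4 * \<alpha>\<close> keeps the weights
  non-negative.\<close>

lemma sphere_points_with_moments:
  fixes p q :: "real ^ 3" and \<alpha> \<beta> :: real
  assumes pq: "p \<bullet> q = 0" "(norm p)\<^sup>2 + (norm q)\<^sup>2 = 1" "p \<noteq> 0"
    and \<alpha>\<beta>: "0 < \<alpha>" "0 \<le> \<beta>" "3 * \<alpha> + \<beta> = 1" "\<beta>\<^sup>2 \<le> 4 * \<alpha>"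
  obtains I :: "(real \<times> real \<times> real) set" and t w where
    "finite I" "\<And>i. i \<in> I \<Longrightarrow> 0 \<le> t i" "\<And>i. i \<in> I \<Longrightarrow> w i \<in> S2" "(\<Sum>i\<in>I. t i) = 1"
    "\<And>m. (\<Sum>i\<in>I. t i * w i $ m) = - \<beta> * cross3 p q $ m"
    "\<And>m n. (\<Sum>i\<in>I. t i * (w i $ m * w i $ n)) = (if m = n then \<alpha> else 0) + \<beta> * (p $ m * p $ n + q $ m * q $ n)"
proof -
  obtain a b e1 e2 where e: "norm e1 = 1" "norm e2 = 1" "e1 \<bullet> e2 = 0" "p = a *\<^sub>R e1" "q = b *\<^sub>R e2"
    using orthonormal_frame_exists[OF pq(3,1)] .
  define e3 where "e3 = cross3 e1 e2"
  have ab: "a\<^sup>2 + b\<^sup>2 = 1" using pq(2) e by simp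
  have e3: "norm e3 = 1" "e1 \<bullet> e3 = 0" "e2 \<bullet> e3 = 0"
    using cross3_frame_completeness(1)[OF e(1-3)] by (simp_all add: e3_def dot_cross_self)
  \<comment> \<open>The squared coordinates are the eigenvalues of the required second-moment
    matrix, which is diagonal in the frame \<open>e1\<close>, \<open>e2\<close>,
    \<open>e3\<close>.\<close>
  define x y z where "x = sqrt (\<alpha> + \<beta> * a\<^sup>2)" and "y = sqrt (\<alpha> + \<beta> * b\<^sup>2)" and "z = sqrt \<alpha>"
  have sq: "x\<^sup>2 = \<alpha> + \<beta> * a\<^sup>2" "y\<^sup>2 = \<alpha> + \<beta> * b\<^sup>2" "z\<^sup>2 = \<alpha>" and z: "z > 0"
    using \<alpha>\<beta> by (simp_all add: x_def y_def z_def)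
  \<comment> \<open>the bias of the sign along \<open>e3\<close>, chosen to produce the first moment\<close>
  define k where "k = - \<beta> * a * b / z"
  have kz: "k * z = - \<beta> * a * b" using z by (simp add: k_def)
  \<comment> \<open>As a^2 + b^2 = 1, the product |a b| is at most 1/2, so the left side is at most
    \<beta>^2 / 4, hence at most \<alpha>.\<close>
  have "(\<beta> * a * b)\<^sup>2 \<le> z\<^sup>2"
  proof -
    have "4 * (a\<^sup>2 * b\<^sup>2) \<le> (a\<^sup>2 + b\<^sup>2)\<^sup>2"
      using zero_le_power2[of "a\<^sup>2 - b\<^sup>2"] by (simp add: power2_eq_square algebra_simps)
    then have "\<beta>\<^sup>2 * (4 * (a\<^sup>2 * b\<^sup>2)) \<le> \<beta>\<^sup>2 * 1" unfolding ab by (intro mult_left_mono) auto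
    then show ?thesis using \<alpha>\<beta>(4) sq(3) by (simp add: power_mult_distrib)
  qed
  then have "\<bar>\<beta> * a * b\<bar> \<le> z" using z by (simp add: abs_le_square_iff[symmetric])
  then have k: "\<bar>k\<bar> \<le> 1" using z by (simp add: k_def abs_mult)
  define I where "I = {-1, 1::real} \<times> {-1, 1::real} \<times> {-1, 1::real}"
  define t where "t = (\<lambda>(r::real, s::real, u). (1 + k * u) / 8)"
  define w where "w = (\<lambda>(r, s, u). (r * x) *\<^sub>R e1 + (s * y) *\<^sub>R e2 + (u * z) *\<^sub>R e3)"
  have sum_I: "sum f I = f (1,1,1) + f (1,1,-1) + f (1,-1,1) + f (1,-1,-1)
     + f (-1,1,1) + f (-1,1,-1) + f (-1,-1,1) + f (-1,-1,-1)" for f :: "_ \<Rightarrow> real"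
    by (simp add: I_def sum.cartesian_product[symmetric])
  show ?thesis
  proof (rule that[of I t w])
    show "finite I" by (simp add: I_def)
    show "0 \<le> t i" if "i \<in> I" for i using that k by (auto simp: I_def t_def)
    show "w i \<in> S2" if "i \<in> I" for i
    proof -
      obtain r s u where i: "i = (r, s, u)" "r\<^sup>2 = 1" "s\<^sup>2 = 1" "u\<^sup>2 = 1" using \<open>i \<in> I\<close> by (auto simp: I_def)
      have ee: "e1 \<bullet> e1 = 1" "e2 \<bullet> e2 = 1" "e3 \<bullet> e3 = 1" using e(1,2) e3(1) by (simp_all add: norm_eq_1)
      have "w i \<bullet> w i = r\<^sup>2 * x\<^sup>2 + s\<^sup>2 * y\<^sup>2 + u\<^sup>2 * z\<^sup>2"
        using e(3) e3(2,3) ee by (simp add: w_def i inner_add_left inner_add_right inner_commute power2_eq_square)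
      also have "\<dots> = 3 * \<alpha> + \<beta> * (a\<^sup>2 + b\<^sup>2)" by (simp add: i(2-4) sq algebra_simps)
      finally show ?thesis using ab \<alpha>\<beta>(3) by (simp add: norm_eq_1)
    qed
    show "(\<Sum>i\<in>I. t i) = 1" by (simp add: sum_I t_def add_divide_distrib diff_divide_distrib)
    show "(\<Sum>i\<in>I. t i * w i $ m) = - \<beta> * cross3 p q $ m" for m
    proof -
      \<comment> \<open>Terms odd in the first or second sign average out; along \<open>e3\<close>
        the bias \<open>k * u\<close> meets the coordinate \<open>u * z\<close>, and
        \<open>u * u\<close> is 1.\<close>
      have "(\<Sum>i\<in>I. t i * w i $ m) = (k * z) * e3 $ m"
        by (simp add: sum_I t_def w_def field_simps)
      then show ?thesis by (simp add: kz e e3_def cross_mult_left cross_mult_right)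
    qed
    show "(\<Sum>i\<in>I. t i * (w i $ m * w i $ n)) = (if m = n then \<alpha> else 0) + \<beta> * (p $ m * p $ n + q $ m * q $ n)" for m n
    proof -
      have "(\<Sum>i\<in>I. t i * (w i $ m * w i $ n)) = x\<^sup>2 * (e1 $ m * e1 $ n) + y\<^sup>2 * (e2 $ m * e2 $ n) + z\<^sup>2 * (e3 $ m * e3 $ n)"
        by (simp add: sum_I t_def w_def field_simps power2_eq_square)
      also have "\<dots> = \<alpha> * (e1 $ m * e1 $ n + e2 $ m * e2 $ n + e3 $ m * e3 $ n) + \<beta> * (p $ m * p $ n + q $ m * q $ n)"
        unfolding sq e by (simp add: algebra_simps power2_eq_square)
      finally show ?thesis by (simp add: e3_def cross3_frame_completeness(2)[OF e(1-3)])
    qed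
  qed
qed

text \<open>Averaging is linear, so each monomial is replaced by its moment. The ten coefficients
  are separate parameters so that they can be instantiated for each entry of the projector.\<close>

lemma quadratic_moment_sum:
  fixes t :: "'i \<Rightarrow> real" and w :: "'i \<Rightarrow> real ^ 3" and P :: "real ^ 3 \<Rightarrow> complex"
  assumes P: "\<And>v. P v = k + lx * of_real (v $ 1) + ly * of_real (v $ 2) + lz * of_real (v $ 3)
      + hxx * of_real (v $ 1 * v $ 1) + hyy * of_real (v $ 2 * v $ 2) + hzz * of_real (v $ 3 * v $ 3)
      + hxy * of_real (v $ 1 * v $ 2) + hxz * of_real (v $ 1 * v $ 3) + hyz * of_real (v $ 2 * v $ 3)"
    and t: "(\<Sum>i\<in>I. t i) = 1"
    and c: "\<And>m. (\<Sum>i\<in>I. t i * w i $ m) = c m"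
    and T: "\<And>m n. (\<Sum>i\<in>I. t i * (w i $ m * w i $ n)) = T m n"
  shows "(\<Sum>i\<in>I. of_real (t i) * P (w i)) = k + lx * of_real (c 1) + ly * of_real (c 2) + lz * of_real (c 3)
      + hxx * of_real (T 1 1) + hyy * of_real (T 2 2) + hzz * of_real (T 3 3)
      + hxy * of_real (T 1 2) + hxz * of_real (T 1 3) + hyz * of_real (T 2 3)"
  unfolding c[symmetric] T[symmetric] P
  using arg_cong[OF t, of "\<lambda>x. k * complex_of_real x"]
  by (simp add: sum.distrib sum_distrib_left algebra_simps)

section \<open>Spin-1 vectors in the Cartesian basis\<close>

lemma unit_rotation_to_nonneg:
  fixes c :: complex
  obtains \<omega> where "cmod \<omega> = 1" "Im (\<omega>\<^sup>2 * c) = 0" "0 \<le> Re (\<omega>\<^sup>2 * c)"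
proof -
  \<comment> \<open>Half the argument is removed because the phase enters squared.\<close>
  define \<omega> where "\<omega> = cis (- Arg c / 2)"
  have "\<omega>\<^sup>2 * c = \<omega>\<^sup>2 * (of_real (cmod c) * cis (Arg c))" by (metis rcis_cmod_Arg rcis_def)
  also have "\<dots> = of_real (cmod c) * (cis (- Arg c / 2) * cis (- Arg c / 2) * cis (Arg c))"
    by (simp add: \<omega>_def power2_eq_square)
  also have "cis (- Arg c / 2) * cis (- Arg c / 2) * cis (Arg c) = 1"
    by (simp add: cis_mult)
  finally show ?thesis using that[of \<omega>] by (simp add: \<omega>_def)
qed

lemma spin1_projector_entry:
  "spin1_projector v $$ (0,0) = (1 + of_real (v$3))\<^sup>2 / 4"
  "spin1_projector v $$ (0,1) = of_real (sqrt 2) * (1 + of_real (v$3)) * (of_real (v$1) - \<i> * of_real (v$2)) / 4"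
  "spin1_projector v $$ (0,2) = (of_real (v$1) - \<i> * of_real (v$2))\<^sup>2 / 4"
  "spin1_projector v $$ (1,0) = of_real (sqrt 2) * (1 + of_real (v$3)) * (of_real (v$1) + \<i> * of_real (v$2)) / 4"
  "spin1_projector v $$ (1,1) = (1 - (of_real (v$3))\<^sup>2) / 2"
  "spin1_projector v $$ (1,2) = of_real (sqrt 2) * (1 - of_real (v$3)) * (of_real (v$1) - \<i> * of_real (v$2)) / 4"
  "spin1_projector v $$ (2,0) = (of_real (v$1) + \<i> * of_real (v$2))\<^sup>2 / 4"
  "spin1_projector v $$ (2,1) = of_real (sqrt 2) * (1 - of_real (v$3)) * (of_real (v$1) + \<i> * of_real (v$2)) / 4"
  "spin1_projector v $$ (2,2) = (1 - of_real (v$3))\<^sup>2 / 4"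
proof -
  have "Complex (v$1) (- (v$2)) = of_real (v$1) - \<i> * of_real (v$2)"
    "cnj (Complex (v$1) (- (v$2))) = of_real (v$1) + \<i> * of_real (v$2)"
    by (simp_all add: complex_eq_iff)
  then show
  "spin1_projector v $$ (0,0) = (1 + of_real (v$3))\<^sup>2 / 4"
  "spin1_projector v $$ (0,1) = of_real (sqrt 2) * (1 + of_real (v$3)) * (of_real (v$1) - \<i> * of_real (v$2)) / 4"
  "spin1_projector v $$ (0,2) = (of_real (v$1) - \<i> * of_real (v$2))\<^sup>2 / 4"
  "spin1_projector v $$ (1,0) = of_real (sqrt 2) * (1 + of_real (v$3)) * (of_real (v$1) + \<i> * of_real (v$2)) / 4"
  "spin1_projector v $$ (1,1) = (1 - (of_real (v$3))\<^sup>2) / 2"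
  "spin1_projector v $$ (1,2) = of_real (sqrt 2) * (1 - of_real (v$3)) * (of_real (v$1) - \<i> * of_real (v$2)) / 4"
  "spin1_projector v $$ (2,0) = (of_real (v$1) + \<i> * of_real (v$2))\<^sup>2 / 4"
  "spin1_projector v $$ (2,1) = of_real (sqrt 2) * (1 - of_real (v$3)) * (of_real (v$1) + \<i> * of_real (v$2)) / 4"
  "spin1_projector v $$ (2,2) = (1 - of_real (v$3))\<^sup>2 / 4"
    by (simp_all add: spin1_projector_def Let_def mat_of_rows_list_def)
qed

text \<open>
  In the basis \<open>p + i q = (x, y, z)\<close> below, coherent states are the isotropic vectors
  \<open>x\<^sup>2 + y\<^sup>2 + z\<^sup>2 = 0\<close>. The phase makes this quadratic form real and non-negative, hence \<open>p \<noteq> 0\<close>.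
\<close>

lemma cartesian_phase:
  fixes f0 f1 f2 :: complex
  assumes n: "(cmod f0)\<^sup>2 + (cmod f1)\<^sup>2 + (cmod f2)\<^sup>2 = 1"
  obtains \<omega> :: complex and p q :: "real ^ 3" where "cmod \<omega> = 1"
    "p \<bullet> q = 0" "(norm p)\<^sup>2 + (norm q)\<^sup>2 = 1" "p \<noteq> 0"
    "\<omega> * f0 = - (Complex (p $ 1) (q $ 1) - \<i> * Complex (p $ 2) (q $ 2)) / of_real (sqrt 2)"
    "\<omega> * f1 = Complex (p $ 3) (q $ 3)"
    "\<omega> * f2 = (Complex (p $ 1) (q $ 1) + \<i> * Complex (p $ 2) (q $ 2)) / of_real (sqrt 2)"
proof -
  obtain \<omega> where \<omega>: "cmod \<omega> = 1" "Im (\<omega>\<^sup>2 * (f1\<^sup>2 - 2 * f0 * f2)) = 0" "0 \<le> Re (\<omega>\<^sup>2 * (f1\<^sup>2 - 2 * f0 * f2))"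
    using unit_rotation_to_nonneg .
  define s where "s = complex_of_real (sqrt 2)"
  have s: "s * s = 2" by (simp add: s_def flip: of_real_mult)
  then have s0: "s \<noteq> 0" by auto
  \<comment> \<open>The Cartesian coordinates of \<omega> f, found by solving the last three
    conclusions for the complex numbers formed from \<open>p\<close> and \<open>q\<close>.\<close>
  define x y z where "x = \<omega> * (f2 - f0) / s" and "y = - \<i> * \<omega> * (f0 + f2) / s" and "z = \<omega> * f1"
  have sq: "x\<^sup>2 + y\<^sup>2 + z\<^sup>2 = \<omega>\<^sup>2 * (f1\<^sup>2 - 2 * f0 * f2)"
    using s0 by (simp add: x_def y_def z_def power_divide power_mult_distrib power2_eq_square[of s] s)
      (simp add: power2_eq_square field_simps)
  have f: "\<omega> * f0 = - (x - \<i> * y) / s" "\<omega> * f2 = (x + \<i> * y) / s"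
    using s s0 by (simp_all add: x_def y_def field_simps)
  \<comment> \<open>The parallelogram law shows that the change of basis preserves the norm.\<close>
  have par: "(cmod (u - v))\<^sup>2 + (cmod (u + v))\<^sup>2 = 2 * ((cmod u)\<^sup>2 + (cmod v)\<^sup>2)" for u v :: complex
    by (simp add: cmod_power2) (simp add: power2_eq_square algebra_simps)
  have "(cmod x)\<^sup>2 + (cmod y)\<^sup>2 = (cmod f0)\<^sup>2 + (cmod f2)\<^sup>2"
    using par[of f2 f0] by (simp add: x_def y_def s_def norm_divide norm_mult power_divide power_mult_distrib \<omega>(1) add.commute add_divide_distrib[symmetric])
  then have nn: "(cmod x)\<^sup>2 + (cmod y)\<^sup>2 + (cmod z)\<^sup>2 = 1" using n by (simp add: z_def norm_mult \<omega>(1))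
  define p :: "real ^ 3" where "p = vector [Re x, Re y, Re z]"
  define q :: "real ^ 3" where "q = vector [Im x, Im y, Im z]"
  have pn: "(norm p)\<^sup>2 = (Re x)\<^sup>2 + (Re y)\<^sup>2 + (Re z)\<^sup>2" and qn: "(norm q)\<^sup>2 = (Im x)\<^sup>2 + (Im y)\<^sup>2 + (Im z)\<^sup>2"
    unfolding power2_norm_eq_inner by (simp_all add: inner_vec_def sum_3 p_def q_def power2_eq_square)
  \<comment> \<open>The quadratic form at p + i q is |p|^2 - |q|^2 + 2 i (p \<bullet> q), so its
    imaginary part controls orthogonality and its real part compares the norms.\<close>
  have "p \<bullet> q = Im (x\<^sup>2 + y\<^sup>2 + z\<^sup>2) / 2"
    by (simp add: inner_vec_def sum_3 p_def q_def power2_eq_square)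
  then have 1: "p \<bullet> q = 0" using \<omega>(2) by (simp add: sq)
  have 2: "(norm p)\<^sup>2 + (norm q)\<^sup>2 = 1" using nn by (simp add: pn qn cmod_power2)
  have "Re (x\<^sup>2 + y\<^sup>2 + z\<^sup>2) = (norm p)\<^sup>2 - (norm q)\<^sup>2" unfolding pn qn by (simp add: power2_eq_square)
  then have "(norm q)\<^sup>2 \<le> (norm p)\<^sup>2" using \<omega>(3) by (simp add: sq)
  with 2 have 3: "p \<noteq> 0" by auto
  have C: "Complex (p $ 1) (q $ 1) = x" "Complex (p $ 2) (q $ 2) = y" "Complex (p $ 3) (q $ 3) = z"
    by (simp_all add: p_def q_def)
  show ?thesis by (rule that[OF \<omega>(1) 1 2 3]) (simp_all add: C f s_def[symmetric] z_def)
qed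

text \<open>The rank-one operator of p + i q has real part \<open>p p^T + q q^T\<close> and an
  antisymmetric imaginary part encoded by the cross product of \<open>p\<close> and
  \<open>q\<close>. These are the second and first moments that the projectors see, so the entries
  agree one by one.\<close>

lemma spin1_projector_mean_eq:
  fixes p q :: "real ^ 3" and f :: "nat \<Rightarrow> complex" and c T
  assumes n: "(norm p)\<^sup>2 + (norm q)\<^sup>2 = 1"
    and f: "f 0 = - (Complex (p $ 1) (q $ 1) - \<i> * Complex (p $ 2) (q $ 2)) / of_real (sqrt 2)"
    "f 1 = Complex (p $ 3) (q $ 3)"
    "f 2 = (Complex (p $ 1) (q $ 1) + \<i> * Complex (p $ 2) (q $ 2)) / of_real (sqrt 2)"
    and I: "(\<Sum>i\<in>I. t i) = 1"
    and c: "\<And>m. (\<Sum>i\<in>I. t i * w i $ m) = - (4/7) * cross3 p q $ m"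
    and T: "\<And>m n. (\<Sum>i\<in>I. t i * (w i $ m * w i $ n)) = (if m = n then 1/7 else 0) + 4/7 * (p $ m * p $ n + q $ m * q $ n)"
    and rc: "r \<le> 2" "k \<le> 2"
  shows "(\<Sum>i\<in>I. of_real (t i) * spin1_projector (w i) $$ (r, k)) = (if r = k then 3/7 else 0) - 2/7 * (f r * cnj (f k))"
proof -
  define s where "s = complex_of_real (sqrt 2)"
  have s: "s * s = 2" "s * (s * x) = 2 * x" for x by (simp_all add: s_def mult.assoc[symmetric] flip: of_real_mult)
  define x y z where "x = Complex (p $ 1) (q $ 1)" and "y = Complex (p $ 2) (q $ 2)" and "z = Complex (p $ 3) (q $ 3)"
  have fs: "f 0 = - (s * (x - \<i> * y)) / 2" "f 1 = z" "f 2 = s * (x + \<i> * y) / 2"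
  proof -
    have d: "v / s = s * v / 2" for v using s(1) by (auto simp: divide_eq_eq mult_ac)
    then show "f 0 = - (s * (x - \<i> * y)) / 2" "f 1 = z" "f 2 = s * (x + \<i> * y) / 2"
      unfolding f s_def[symmetric] x_def[symmetric] y_def[symmetric] z_def[symmetric] d by (simp_all add: algebra_simps)
  qed
  have cs: "cnj s = s" by (simp add: s_def)
  have ff: "f 0 * cnj (f 0) = (x - \<i> * y) * (cnj x + \<i> * cnj y) / 2"
    "f 0 * cnj (f 1) = - s * ((x - \<i> * y) * cnj z / 2)"
    "f 0 * cnj (f 2) = - ((x - \<i> * y) * (cnj x - \<i> * cnj y) / 2)"
    "f 1 * cnj (f 0) = - s * (z * (cnj x + \<i> * cnj y) / 2)"
    "f 1 * cnj (f 1) = z * cnj z"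
    "f 1 * cnj (f 2) = s * (z * (cnj x - \<i> * cnj y) / 2)"
    "f 2 * cnj (f 0) = - ((x + \<i> * y) * (cnj x + \<i> * cnj y) / 2)"
    "f 2 * cnj (f 1) = s * ((x + \<i> * y) * cnj z / 2)"
    "f 2 * cnj (f 2) = (x + \<i> * y) * (cnj x - \<i> * cnj y) / 2"
    unfolding fs by (simp_all add: cs s mult_ac)
  \<comment> \<open>The normalisation eliminates |x|^2 + |y|^2 in favour of |z|^2 in the two outer
    diagonal entries.\<close>
  have n': "p$1 * p$1 + p$2 * p$2 + p$3 * p$3 + q$1 * q$1 + q$2 * q$2 + q$3 * q$3 = 1"
    using n by (simp add: power2_norm_eq_inner inner_vec_def sum_3)
  let ?S = "\<lambda>r k. \<Sum>i\<in>I. of_real (t i) * spin1_projector (w i) $$ (r, k)"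
  let ?R = "\<lambda>r k::nat. (if r = k then 3/7 else 0) - 2/7 * (f r * cnj (f k))"
  note moment = quadratic_moment_sum[OF _ I c T]
  \<comment> \<open>Here and below, the \<open>where\<close> clause lists the coefficients of the
    entry as a quadratic polynomial in the coordinates; real and imaginary parts are then compared
    after inserting the moments.\<close>
  have e00: "?S 0 0 = ?R 0 0"
    by (subst moment[where k = "1/4" and lx = "0" and ly = "0" and lz = "1/2" and hxx = "0" and hyy = "0" and hzz = "1/4" and hxy = "0" and hxz = "0" and hyz = "0"],
      simp add: spin1_projector_entry[folded s_def, unfolded One_nat_def] power2_eq_square field_simps,
      simp add: ff[unfolded One_nat_def] cross_components x_def y_def z_def complex_eq_iff)
     (use n' in \<open>simp add: s_def algebra_simps add_divide_distrib diff_divide_distrib\<close>)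
  have e01: "?S 0 1 = ?R 0 1"
    by (subst moment[where k = "0" and lx = "s/4" and ly = "-(\<i> * s / 4)" and lz = "0" and hxx = "0" and hyy = "0" and hzz = "0" and hxy = "0" and hxz = "s/4" and hyz = "-(\<i> * s / 4)"],
      simp add: spin1_projector_entry[folded s_def, unfolded One_nat_def] power2_eq_square field_simps,
      simp add: ff[unfolded One_nat_def] cross_components x_def y_def z_def complex_eq_iff)
     (use n' in \<open>simp add: s_def algebra_simps add_divide_distrib diff_divide_distrib\<close>)
  have e02: "?S 0 2 = ?R 0 2"
    by (subst moment[where k = "0" and lx = "0" and ly = "0" and lz = "0" and hxx = "1/4" and hyy = "-1/4" and hzz = "0" and hxy = "-\<i>/2" and hxz = "0" and hyz = "0"],
      simp add: spin1_projector_entry[folded s_def, unfolded One_nat_def] power2_eq_square field_simps,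
      simp add: ff[unfolded One_nat_def] cross_components x_def y_def z_def complex_eq_iff)
     (use n' in \<open>simp add: s_def algebra_simps add_divide_distrib diff_divide_distrib\<close>)
  have e10: "?S 1 0 = ?R 1 0"
    by (subst moment[where k = "0" and lx = "s/4" and ly = "\<i> * s / 4" and lz = "0" and hxx = "0" and hyy = "0" and hzz = "0" and hxy = "0" and hxz = "s/4" and hyz = "\<i> * s / 4"],
      simp add: spin1_projector_entry[folded s_def, unfolded One_nat_def] power2_eq_square field_simps,
      simp add: ff[unfolded One_nat_def] cross_components x_def y_def z_def complex_eq_iff)
     (use n' in \<open>simp add: s_def algebra_simps add_divide_distrib diff_divide_distrib\<close>)
  have e11: "?S 1 1 = ?R 1 1"
    by (subst moment[where k = "1/2" and lx = "0" and ly = "0" and lz = "0" and hxx = "0" and hyy = "0" and hzz = "-1/2" and hxy = "0" and hxz = "0" and hyz = "0"],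
      simp add: spin1_projector_entry[folded s_def, unfolded One_nat_def] power2_eq_square field_simps,
      simp add: ff[unfolded One_nat_def] cross_components x_def y_def z_def complex_eq_iff)
     (use n' in \<open>simp add: s_def algebra_simps add_divide_distrib diff_divide_distrib\<close>)
  have e12: "?S 1 2 = ?R 1 2"
    by (subst moment[where k = "0" and lx = "s/4" and ly = "-(\<i> * s / 4)" and lz = "0" and hxx = "0" and hyy = "0" and hzz = "0" and hxy = "0" and hxz = "-(s/4)" and hyz = "\<i> * s / 4"],
      simp add: spin1_projector_entry[folded s_def, unfolded One_nat_def] power2_eq_square field_simps,
      simp add: ff[unfolded One_nat_def] cross_components x_def y_def z_def complex_eq_iff)
     (use n' in \<open>simp add: s_def algebra_simps add_divide_distrib diff_divide_distrib\<close>)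
  have e20: "?S 2 0 = ?R 2 0"
    by (subst moment[where k = "0" and lx = "0" and ly = "0" and lz = "0" and hxx = "1/4" and hyy = "-1/4" and hzz = "0" and hxy = "\<i>/2" and hxz = "0" and hyz = "0"],
      simp add: spin1_projector_entry[folded s_def, unfolded One_nat_def] power2_eq_square field_simps,
      simp add: ff[unfolded One_nat_def] cross_components x_def y_def z_def complex_eq_iff)
     (use n' in \<open>simp add: s_def algebra_simps add_divide_distrib diff_divide_distrib\<close>)
  have e21: "?S 2 1 = ?R 2 1"
    by (subst moment[where k = "0" and lx = "s/4" and ly = "\<i> * s / 4" and lz = "0" and hxx = "0" and hyy = "0" and hzz = "0" and hxy = "0" and hxz = "-(s/4)" and hyz = "-(\<i> * s / 4)"],
      simp add: spin1_projector_entry[folded s_def, unfolded One_nat_def] power2_eq_square field_simps,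
      simp add: ff[unfolded One_nat_def] cross_components x_def y_def z_def complex_eq_iff)
     (use n' in \<open>simp add: s_def algebra_simps add_divide_distrib diff_divide_distrib\<close>)
  have e22: "?S 2 2 = ?R 2 2"
    by (subst moment[where k = "1/4" and lx = "0" and ly = "0" and lz = "-1/2" and hxx = "0" and hyy = "0" and hzz = "1/4" and hxy = "0" and hxz = "0" and hyz = "0"],
      simp add: spin1_projector_entry[folded s_def, unfolded One_nat_def] power2_eq_square field_simps,
      simp add: ff[unfolded One_nat_def] cross_components x_def y_def z_def complex_eq_iff)
     (use n' in \<open>simp add: s_def algebra_simps add_divide_distrib diff_divide_distrib\<close>)
  have "r \<in> {0,1,2}" "k \<in> {0,1,2}" using rc by auto
  then show ?thesis using e00 e01 e02 e10 e11 e12 e20 e21 e22 by auto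
qed

text \<open>The conjugate equals 3/7 times the identity minus 2/7 times the projector onto column 0
  of \<open>U\<close>. The phase of that column is free, so it can be brought to Cartesian form with
  \<open>p \<bullet> q = 0\<close>.\<close>

lemma admits_positive_P_conj_by:
  assumes U: "U \<in> SU 3"
  shows "admits_positive_P 2 (conj_by U (mat_diag 3 (\<lambda>k. complex_of_real (if k = 0 then 1/7 else 3/7))))"
proof -
  have U': "U \<in> carrier_mat 3 3" "U * mat_adjoint U = 1\<^sub>m 3" using U by (auto simp: SU_def)
  have sum3: "(\<Sum>i<3. h i) = h 0 + h 1 + h 2" for h :: "nat \<Rightarrow> 'a::comm_monoid_add" by (simp add: lessThan_3 add.assoc)
  have "(cmod (U $$ (0,0)))\<^sup>2 + (cmod (U $$ (1,0)))\<^sup>2 + (cmod (U $$ (2,0)))\<^sup>2 = 1"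
    using unitary_column_sum[OF U', of 0] by (simp add: sum3)
  then obtain \<omega> and p q :: "real ^ 3" where \<omega>: "cmod \<omega> = 1"
    and pq: "p \<bullet> q = 0" "(norm p)\<^sup>2 + (norm q)\<^sup>2 = 1" "p \<noteq> 0"
    and f: "\<omega> * U $$ (0,0) = - (Complex (p $ 1) (q $ 1) - \<i> * Complex (p $ 2) (q $ 2)) / of_real (sqrt 2)"
    "\<omega> * U $$ (1,0) = Complex (p $ 3) (q $ 3)"
    "\<omega> * U $$ (2,0) = (Complex (p $ 1) (q $ 1) + \<i> * Complex (p $ 2) (q $ 2)) / of_real (sqrt 2)"
    by (rule cartesian_phase)
  \<comment> \<open>The parameters are admissible: 3/7 + 4/7 = 1 and 16/49 is at most 4/7 =
    28/49.\<close>
  obtain I :: "(real \<times> real \<times> real) set" and t w where I: "finite I" "\<And>i. i \<in> I \<Longrightarrow> 0 \<le> t i" "\<And>i. i \<in> I \<Longrightarrow> w i \<in> S2"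
    and m: "(\<Sum>i\<in>I. t i) = 1"
    "\<And>m. (\<Sum>i\<in>I. t i * w i $ m) = - (4/7) * cross3 p q $ m"
    "\<And>m n. (\<Sum>i\<in>I. t i * (w i $ m * w i $ n)) = (if m = n then 1/7 else 0) + 4/7 * (p $ m * p $ n + q $ m * q $ n)"
    by (rule sphere_points_with_moments[OF pq, of "1/7" "4/7"]) (auto simp: power2_eq_square)
  show ?thesis
  proof (rule admits_positive_P_2_convex_combination[OF I])
    fix r c :: nat assume rc: "r \<le> 2" "c \<le> 2"
    have "conj_by U (mat_diag 3 (\<lambda>k. complex_of_real (if k = 0 then 1/7 else 3/7))) $$ (r, c)
       = 3/7 * (\<Sum>k<3. U $$ (r,k) * cnj (U $$ (c,k))) - 2/7 * (U $$ (r,0) * cnj (U $$ (c,0)))"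
      using rc by (subst conj_by_diag_entry[OF U'(1)]) (simp_all add: sum3 field_simps)
    also have "(\<Sum>k<3. U $$ (r,k) * cnj (U $$ (c,k))) = (U * mat_adjoint U) $$ (r, c)"
      using U'(1) rc by (auto simp: mat_adjoint_simps scalar_prod_def lessThan_atLeast0 intro!: sum.cong)
    also have "3/7 * \<dots> = (if r = c then 3/7 else 0)" using rc by (simp add: U'(2))
    \<comment> \<open>A phase of modulus one cancels in the rank-one operator.\<close>
    also have "U $$ (r,0) * cnj (U $$ (c,0)) = (\<omega> * U $$ (r,0)) * cnj (\<omega> * U $$ (c,0))"
    proof -
      have "\<omega> * cnj \<omega> = 1" using \<omega> by (simp flip: complex_norm_square)
      then show ?thesis by (metis complex_cnj_mult mult.assoc mult.left_commute mult.right_neutral)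
    qed
    finally show "conj_by U (mat_diag 3 (\<lambda>k. complex_of_real (if k = 0 then 1/7 else 3/7))) $$ (r, c)
       = (\<Sum>i\<in>I. of_real (t i) * spin1_projector (w i) $$ (r, c))"
      using spin1_projector_mean_eq[of p q "\<lambda>r. \<omega> * U $$ (r,0)", OF pq(2) f m rc] by simp
  qed
qed

section \<open>Incomparability of the two absolute positivity notions\<close>

theorem mainTheorem4:
  shows "\<not> AWP 2 \<subseteq> SAS 2 \<and> \<not> SAS 2 \<subseteq> AWP 2 \<and>
    (\<exists>\<rho>. spin_state 2 \<rho> \<and> admits_positive_P 2 \<rho> \<and> \<rho> \<in> SAS 2 \<and> (\<exists>\<Omega>\<in>S2. wigner 2 \<rho> \<Omega> < 0)) \<and>
    (\<exists>\<rho>. spin_state 2 \<rho> \<and> \<rho> \<in> AWP 2 \<and> (\<forall>\<Omega>\<in>S2. 0 \<le> wigner 2 \<rho> \<Omega>) \<and> \<not> admits_positive_P 2 \<rho>)"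
proof -
  define \<rho> where "\<rho> = mat_diag 3 (\<lambda>k. complex_of_real (if k = 0 then 1/7 else 3/7))"
  define \<sigma> where "\<sigma> = mat_diag 3 (\<lambda>k. complex_of_real (if k = 1 then 13/25 else 6/25))"
  have "spin_state 2 \<rho>"
    using spin_state_diag[of 2 "\<lambda>k. if k = 0 then 1/7 else 3/7"]
    by (simp add: \<rho>_def numeral_2_eq_2 numeral_3_eq_3)
  then have \<rho>: "spin_state 2 \<rho>" "\<rho> \<in> SAS 2"
    using admits_positive_P_conj_by by (simp_all add: SAS_def \<rho>_def)
  have "spin_state 2 \<sigma>"
    using spin_state_diag[of 2 "\<lambda>k. if k = 1 then 13/25 else 6/25"]
    by (simp add: \<sigma>_def numeral_2_eq_2 numeral_3_eq_3)
  then have \<sigma>: "spin_state 2 \<sigma>" "\<sigma> \<in> AWP 2"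
    using spin1_wigner_nonneg by (simp_all add: AWP_def \<sigma>_def)
  \<comment> \<open>Taking the identity as the unitary specialises membership in \<open>SAS\<close>
    or \<open>AWP\<close> to the state itself.\<close>
  have one: "1\<^sub>m 3 \<in> SU (2 + 1)" and conj_one: "conj_by (1\<^sub>m 3) A = A" if "A \<in> carrier_mat 3 3" for A
    using that by (auto simp: SU_def conj_by_def mat_adjoint_one)
  have carr: "\<rho> \<in> carrier_mat 3 3" "\<sigma> \<in> carrier_mat 3 3" by (simp_all add: \<rho>_def \<sigma>_def)
  have n: "north \<in> S2" by (simp add: north_def)
  have \<rho>P: "admits_positive_P 2 \<rho>"
    using \<rho>(2) one[OF carr(1)] conj_one[OF carr(1)] by (force simp: SAS_def)
  have \<sigma>W: "\<forall>\<Omega>\<in>S2. 0 \<le> wigner 2 \<sigma> \<Omega>"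
    using \<sigma>(2) one[OF carr(2)] conj_one[OF carr(2)] by (force simp: AWP_def)
  have \<rho>W: "wigner 2 \<rho> north < 0" using spin1_wigner_negative by (simp add: \<rho>_def)
  have \<rho>_not: "\<rho> \<notin> AWP 2"
    using \<rho>W n one[OF carr(1)] conj_one[OF carr(1)] by (force simp: AWP_def)
  \<comment> \<open>The witness fails because 13/25 exceeds 6/25 + 6/25.\<close>
  have \<sigma>P: "\<not> admits_positive_P 2 \<sigma>"
    using middle_entry_le_of_admits_positive_P[of \<sigma>] by (auto simp: \<sigma>_def mat_diag_def)
  then have \<sigma>_not: "\<sigma> \<notin> SAS 2"
    using one[OF carr(2)] conj_one[OF carr(2)] by (force simp: SAS_def)
  show ?thesis using \<rho> \<sigma> \<rho>P \<sigma>W \<rho>W n \<rho>_not \<sigma>P \<sigma>_not by blast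
qed

end
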